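(* In dimension $n=1$ there exist a function $v:\mathbb{T}^1\to\mathbb{R}$ with $v\ge0$, and $P\in\mathbb{R}$, $\alpha\geq 0$, such that, for the effective operators $\bar H,\bar b$ associated with the potential $V(y,m)=v(y)+m$, $$\nabla_P\bar H(P,\alpha)\neq\bar b(P,\alpha).$$
   Context: $\mathbb{T}^1=\mathbb{R}/\mathbb{Z}$. The function $v$ is taken of class $C^1$ on $\mathbb{T}^1$. For $P\in\mathbb{R}$, $\alpha\ge0$, and $V(y,m)=v(y)+m$, $\bar H(P,\alpha)$ is the unique constant for which the cell problem $$-\Delta u+\tfrac12|\nabla u+P|^2-\alpha m-v(y)=\bar H(P,\alpha),\quad -\Delta m-\mathrm{div}(m(\nabla u+P))=0\ \text{ on }\mathbb{T}^1,\quad \int_{\mathbb{T}^1}u=0,\ \int_{\mathbb{T}^1}m=1$$ admits a solution $(u,m)$; this solution is unique, $m>0$, with $u\in C^{2,\gamma}$ for every $\gamma\in(0,1)$ and $m\in W^{1,p}$ for every $p>1$. One sets $\bar b(P,\alpha)=\int_{\mathbb{T}^1}(\nabla u+P)\,m\,dy$. In dimension one $\nabla$, $\Delta$, $\mathrm{div}$ denote the corresponding derivatives in $y$, and $\nabla_P\bar H$ is the derivative of $\bar H$ in $P$. *)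

theory Defs
  imports "HOL-Analysis.Analysis"
begin

text \<open>
  Functions on the circle \<open>\<real>/\<int>\<close> are 1-periodic functions on \<open>\<real>\<close> (predicate
  \<open>periodic_fun_simple'\<close>), and integrals over the circle are Lebesgue integrals over the
  period \<open>{0..1}\<close>.
\<close>

definition C1_torus :: "(real \<Rightarrow> real) \<Rightarrow> bool" where
  "C1_torus f \<longleftrightarrow> periodic_fun_simple' f \<and> f C1_differentiable_on UNIV"

text \<open>
  The Hoelder bound uses the distance in \<open>\<real>\<close> instead of that in \<open>\<real>/\<int>\<close>; for periodic
  functions both conditions agree.
\<close>

definition C2_holder_torus :: "real \<Rightarrow> (real \<Rightarrow> real) \<Rightarrow> bool" where
  "C2_holder_torus \<gamma> f \<longleftrightarrow>
     C1_torus f \<and> C1_torus (deriv f) \<and>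
     (\<exists>C. \<forall>x y. \<bar>deriv (deriv f) x - deriv (deriv f) y\<bar> \<le> C * \<bar>x - y\<bar> powr \<gamma>)"

definition Lp_torus :: "real \<Rightarrow> (real \<Rightarrow> real) \<Rightarrow> bool" where
  "Lp_torus p f \<longleftrightarrow>
     set_borel_measurable lborel {0..1} f \<and>
     set_integrable lborel {0..1} (\<lambda>y. \<bar>f y\<bar> powr p)"

definition weak_deriv_torus :: "(real \<Rightarrow> real) \<Rightarrow> (real \<Rightarrow> real) \<Rightarrow> bool" where
  "weak_deriv_torus f g \<longleftrightarrow>
     set_integrable lborel {0..1} f \<and> set_integrable lborel {0..1} g \<and>
     (\<forall>\<phi>. C1_torus \<phi> \<longrightarrow>
        (LINT y:{0..1}|lborel. f y * deriv \<phi> y) = - (LINT y:{0..1}|lborel. g y * \<phi> y))"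

definition W1p_torus :: "real \<Rightarrow> (real \<Rightarrow> real) \<Rightarrow> bool" where
  "W1p_torus p f \<longleftrightarrow> Lp_torus p f \<and> (\<exists>g. weak_deriv_torus f g \<and> Lp_torus p g)"

text \<open>
  Weak form of \<open>- m'' - (m (u' + P))' = 0\<close>, tested against \<open>\<phi>\<close> and integrated by parts once.
\<close>

definition fokker_planck :: "real \<Rightarrow> (real \<Rightarrow> real) \<Rightarrow> (real \<Rightarrow> real) \<Rightarrow> bool" where
  "fokker_planck P u m \<longleftrightarrow>
     (\<exists>g. weak_deriv_torus m g \<and>
       (\<forall>\<phi>. C1_torus \<phi> \<longrightarrow>
          (LINT y:{0..1}|lborel. (g y + m y * (deriv u y + P)) * deriv \<phi> y) = 0))"

text \<open>
  In dimension one every element of \<open>W\<^sup>1\<^sup>,\<^sup>p\<close> has a unique continuous periodic representative;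
  \<open>m\<close> denotes that representative, so that the first equation makes sense at every point.
  The potential is \<open>V(y, m) = v(y) + m\<close>, and \<open>h\<close> is the constant on the right-hand side.
\<close>

definition cell_solution ::
  "(real \<Rightarrow> real) \<Rightarrow> real \<Rightarrow> real \<Rightarrow> real \<Rightarrow> (real \<Rightarrow> real) \<Rightarrow> (real \<Rightarrow> real) \<Rightarrow> bool" where
  "cell_solution v P \<alpha> h u m \<longleftrightarrow>
     (\<forall>\<gamma>. 0 < \<gamma> \<and> \<gamma> < 1 \<longrightarrow> C2_holder_torus \<gamma> u) \<and>
     periodic_fun_simple' m \<and> continuous_on UNIV m \<and> (\<forall>p>1. W1p_torus p m) \<and>
     (\<forall>y. - deriv (deriv u) y + 1/2 * (deriv u y + P)\<^sup>2 - \<alpha> * m y - v y = h) \<and>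
     fokker_planck P u m \<and>
     (LINT y:{0..1}|lborel. u y) = 0 \<and>
     (LINT y:{0..1}|lborel. m y) = 1"

text \<open>
  For \<open>v\<close> of class \<open>C\<^sup>1\<close> and \<open>\<alpha> \<ge> 0\<close> the cell problem has exactly one solution \<open>(h, u, m)\<close>,
  so both descriptions below denote.
\<close>

definition Hbar :: "(real \<Rightarrow> real) \<Rightarrow> real \<Rightarrow> real \<Rightarrow> real" where
  "Hbar v P \<alpha> = (THE h. \<exists>u m. cell_solution v P \<alpha> h u m)"

definition bbar :: "(real \<Rightarrow> real) \<Rightarrow> real \<Rightarrow> real \<Rightarrow> real" where
  "bbar v P \<alpha> =
     (THE b. \<exists>u m. cell_solution v P \<alpha> (Hbar v P \<alpha>) u m \<and>
        b = (LINT y:{0..1}|lborel. (deriv u y + P) * m y))"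

end

theory Submission
  imports Defs
begin

text \<open>
  The idea. Write \<open>w = u' + P\<close> for the drift. The Fokker-Planck equation says that the flux
  \<open>m' + w m\<close> is a constant, and integrating it over a period shows that this constant is
  \<open>\<integral> w m\<close>, the effective drift \<open>b\<close>. Testing the difference of the Hamilton-Jacobi equations of two
  solutions, for \<open>P\<close> and \<open>Q\<close>, with the density \<open>m\<^sub>P\<close> gives the exact identity
  \<open>H(P) - H(Q) = b(P) (P - Q) - 1/2 \<integral> m\<^sub>P (w\<^sub>P - w\<^sub>Q)\<^sup>2 - \<alpha> \<integral> m\<^sub>P (m\<^sub>P - m\<^sub>Q)\<close>
  (lemma \<open>profile_difference\<close>). Adding it to its mirror image yields uniqueness for \<open>\<alpha> > 0\<close>, the
  monotonicity argument of Lasry and Lions (\<open>profile_unique\<close>). Letting \<open>Q \<rightarrow> P\<close>, where the middle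
  term is of second order, yields
  \<open>H'(P) = b(P) - \<alpha>/2 (d/dP) \<integral> m\<^sub>P\<^sup>2\<close> (\<open>effective_derivative\<close>).
  So the two effective quantities can only agree for all \<open>P\<close> in an interval if \<open>\<integral> m\<^sub>P\<^sup>2\<close> is constant
  there, and it is enough to find a potential for which this integral takes two different values.

  Take \<open>\<alpha> = 1\<close> and \<open>v(y) = \<epsilon> (1 + cos (2 \<pi> y))\<close> with a small \<open>\<epsilon>\<close>. With \<open>m = 1 + \<mu>\<close> and
  \<open>w = P + \<omega>\<close> the cell problem becomes \<^emph>\<open>quadratic\<close> in \<open>(\<mu>, \<omega>)\<close>; applying the mean-zero
  primitive \<open>J\<close> on the circle turns it into a fixed-point equation
  \<open>x = A x + P B x + Q(x, x) + z\<close> in a Banach space. As \<open>J\<close> has norm at most \<open>1/2\<close>, this is a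
  contraction near \<open>0\<close> for \<open>|P| \<le> 1/4\<close>; the solution depends differentiably on \<open>P\<close> and differs from
  that of the linear problem \<open>y = A y + P B y + z\<close> by \<open>O(\<epsilon>\<^sup>2)\<close> (locale
  \<open>quadratic_perturbation\<close>). The linear problem is solved by trigonometric functions, with
  \<open>\<mu> = - \<epsilon> cos (2 \<pi> y) / (4 \<pi>\<^sup>2 + P\<^sup>2 + 1)\<close>. Hence
  \<open>\<integral> m\<^sub>P\<^sup>2 = 1 + \<epsilon>\<^sup>2 / (2 (4 \<pi>\<^sup>2 + P\<^sup>2 + 1)\<^sup>2) + O(\<epsilon>\<^sup>3)\<close>, which is not constant for small \<open>\<epsilon>\<close>,
  and the mean value theorem provides the required \<open>P\<close>.
\<close>

section \<open>Calculus of periodic functions\<close>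

abbreviation mean :: "(real \<Rightarrow> real) \<Rightarrow> real" where
  "mean f \<equiv> integral {0..1} f"

abbreviation periodic :: "(real \<Rightarrow> real) \<Rightarrow> bool" where
  "periodic f \<equiv> (\<forall>y. f (y + 1) = f y)"

lemma periodic_fun_iff: "periodic_fun_simple' f \<longleftrightarrow> (\<forall>y. f (y + 1) = f y)"
  by (simp add: periodic_fun_simple'_def)

lemma set_lint_eq_mean:
  assumes "continuous_on UNIV f"
  shows "(LINT y:{0..1}|lborel. f y) = mean f"
  by (rule set_borel_integral_eq_integral, rule borel_integrable_atLeastAtMost')
     (use assms continuous_on_subset in blast)

lemma continuous_integrable [intro]:
  fixes f :: "real \<Rightarrow> real"
  assumes "continuous_on UNIV f"
  shows "f integrable_on {0..1}"
  using assms continuous_on_subset integrable_continuous_real by blast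

lemma mean_add:
  "continuous_on UNIV f \<Longrightarrow> continuous_on UNIV g \<Longrightarrow> mean (\<lambda>y. f y + g y) = mean f + mean g"
  by (rule integral_add) auto

lemma mean_diff:
  "continuous_on UNIV f \<Longrightarrow> continuous_on UNIV g \<Longrightarrow> mean (\<lambda>y. f y - g y) = mean f - mean g"
  by (rule integral_diff) auto

lemma DERIV_UNIV_continuous:
  fixes F :: "real \<Rightarrow> real"
  assumes "\<And>y. (F has_real_derivative f y) (at y)"
  shows "continuous_on UNIV F"
  by (meson assms DERIV_isCont continuous_at_imp_continuous_on)

lemma C1_torusI:
  assumes "\<And>y. (F has_real_derivative f y) (at y)" "continuous_on UNIV f" "\<And>y. F (y + 1) = F y"
  shows "C1_torus F" "deriv F = f"
proof -
  show "deriv F = f" using assms(1) DERIV_imp_deriv by blast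
  show "C1_torus F" unfolding C1_torus_def periodic_fun_iff C1_differentiable_on_def
    using assms by (auto simp: has_real_derivative_iff_has_vector_derivative intro!: exI[of _ f])
qed

lemma C1_torusD:
  assumes "C1_torus F"
  shows "\<And>y. (F has_real_derivative deriv F y) (at y)" "continuous_on UNIV (deriv F)"
    "\<And>y. F (y + 1) = F y" "continuous_on UNIV F"
proof -
  from assms obtain D where D: "\<And>y. (F has_real_derivative D y) (at y)" "continuous_on UNIV D"
    unfolding C1_torus_def C1_differentiable_on_def has_real_derivative_iff_has_vector_derivative by auto
  then have e: "deriv F = D" using DERIV_imp_deriv by blast
  show "\<And>y. (F has_real_derivative deriv F y) (at y)" "continuous_on UNIV (deriv F)"
    using D e by auto
  then show "continuous_on UNIV F" using DERIV_UNIV_continuous by blast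
  show "\<And>y. F (y + 1) = F y" using assms by (auto simp: C1_torus_def periodic_fun_iff)
qed

lemma mean_deriv:
  assumes "\<And>y. (F has_real_derivative f y) (at y)"
  shows "mean f = F 1 - F 0"
proof -
  have "(f has_integral F 1 - F 0) {0..1}"
    by (rule fundamental_theorem_of_calculus)
       (use assms in \<open>auto simp: has_real_derivative_iff_has_vector_derivative
          intro: has_vector_derivative_at_within\<close>)
  then show ?thesis by blast
qed

lemma deriv_periodic:
  assumes "\<And>y. (F has_real_derivative f y) (at y)" "periodic F"
  shows "periodic f"
proof
  fix y
  have "((\<lambda>z. F (z + 1)) has_real_derivative f (y + 1)) (at y)"
    using assms(1)[of "y + 1"] by (simp add: DERIV_shift)
  moreover have "(\<lambda>z. F (z + 1)) = F" using assms(2) by auto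
  ultimately show "f (y + 1) = f y" using assms(1)[of y] DERIV_unique by metis
qed

lemma periodic_mean_deriv:
  assumes "\<And>y. (F has_real_derivative f y) (at y)" "periodic F"
  shows "mean f = 0"
  using mean_deriv[OF assms(1)] assms(2)[rule_format, of 0] by simp

lemma antiderivative_exists:
  fixes f :: "real \<Rightarrow> real"
  assumes "continuous_on UNIV f"
  obtains F where "\<And>y. (F has_real_derivative f y) (at y)"
proof -
  have "\<exists>F. \<forall>x::real. (-\<infinity>::ereal) < x \<longrightarrow> x < (\<infinity>::ereal) \<longrightarrow> (F has_vector_derivative f x) (at x)"
    by (rule einterval_antiderivative) (use assms continuous_on_eq_continuous_at in auto)
  then show ?thesis using that by (auto simp: has_real_derivative_iff_has_vector_derivative)
qed

lemma antiderivative_increment: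
  assumes F: "\<And>y. (F has_real_derivative f y) (at y)" and "periodic f"
  shows "F (y + 1) - F y = mean f"
proof -
  have "((\<lambda>z. F (z + 1) - F z) has_real_derivative 0) (at y)" for y
  proof -
    have "((\<lambda>z. F (z + 1)) has_real_derivative f (y + 1)) (at y)"
      using F[of "y + 1"] by (simp add: DERIV_shift)
    then show ?thesis using DERIV_diff[OF _ F[of y]] assms(2) by fastforce
  qed
  then have "F (y + 1) - F y = F (0 + 1) - F 0" 
    using DERIV_isconst_all[where f = "\<lambda>z. F (z + 1) - F z"] by blast
  then show ?thesis using mean_deriv[OF F] by simp
qed

lemma periodic_antiderivative:
  assumes f: "continuous_on UNIV f" "periodic f" "mean f = 0"
  obtains F where "\<And>y. (F has_real_derivative f y) (at y)" "periodic F" "mean F = 0"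
proof -
  obtain F where F: "\<And>y. (F has_real_derivative f y) (at y)"
    using antiderivative_exists f by blast
  have cF: "continuous_on UNIV F" using F DERIV_UNIV_continuous by blast
  show thesis
  proof (rule that[of "\<lambda>y. F y - mean F"])
    show "((\<lambda>y. F y - mean F) has_real_derivative f y) (at y)" for y
      by (auto intro!: derivative_eq_intros F)
    show "\<forall>y. F (y + 1) - mean F = F y - mean F"
      using antiderivative_increment[OF F f(2)] f(3) by auto
    show "mean (\<lambda>y. F y - mean F) = 0" using mean_diff[OF cF] by simp
  qed
qed

lemma periodic_eqI:
  fixes f g :: "real \<Rightarrow> real"
  assumes "periodic f" "periodic g" "\<And>y. y \<in> {0..1} \<Longrightarrow> f y = g y"
  shows "f = g"
proof
  fix y
  interpret f: periodic_fun_simple' f using assms by unfold_locales auto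
  interpret g: periodic_fun_simple' g using assms by unfold_locales auto
  have "f (frac y) = g (frac y)" using assms(3)[of "frac y"] frac_lt_1[of y] by (simp add: less_imp_le)
  then show "f y = g y" using f.minus_of_int[of y "\<lfloor>y\<rfloor>"] g.minus_of_int[of y "\<lfloor>y\<rfloor>"]
    by (simp add: frac_def)
qed

lemma mean_eq_0_imp:
  assumes "continuous_on UNIV f" "periodic f" "\<And>y. 0 \<le> f y" "mean f = 0"
  shows "f y = 0"
proof -
  have "\<forall>y\<in>{0..1}. f y = 0"
    using integral_eq_0_iff[of 0 1 f] assms continuous_on_subset[of UNIV f "{0..1}"] by simp
  then have "f = (\<lambda>y. 0)" by (intro periodic_eqI assms) auto
  then show ?thesis by simp
qed

lemma mean_by_parts:
  assumes F: "\<And>y. (F has_real_derivative f y) (at y)" "periodic F" "continuous_on UNIV f"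
    and G: "\<And>y. (G has_real_derivative g y) (at y)" "periodic G" "continuous_on UNIV g"
  shows "mean (\<lambda>y. F y * g y) = - mean (\<lambda>y. f y * G y)"
proof -
  have c: "continuous_on UNIV F" "continuous_on UNIV G"
    using F G DERIV_UNIV_continuous by blast+
  have "mean (\<lambda>y. F y * g y + f y * G y) = 0"
  proof (rule periodic_mean_deriv[where F = "\<lambda>y. F y * G y"])
    show "((\<lambda>y. F y * G y) has_real_derivative F y * g y + f y * G y) (at y)" for y
      by (auto intro!: derivative_eq_intros F G)
  qed (use F G in auto)
  moreover have "mean (\<lambda>y. F y * g y + f y * G y) = mean (\<lambda>y. F y * g y) + mean (\<lambda>y. f y * G y)"
    using c F G by (intro mean_add continuous_intros) auto
  ultimately show ?thesis by simp
qed

section \<open>From weak to classical solutions\<close>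

lemma set_integrable_mult_continuous:
  fixes g \<phi> :: "real \<Rightarrow> real"
  assumes "set_integrable lborel {0..1} g" "continuous_on UNIV \<phi>"
  shows "set_integrable lborel {0..1} (\<lambda>y. g y * \<phi> y)"
proof -
  have "compact (\<phi> ` {0..1})" by (rule compact_continuous_image) (use assms continuous_on_subset in auto)
  then obtain B where B: "\<And>y. y \<in> {0..1} \<Longrightarrow> \<bar>\<phi> y\<bar> \<le> B"
    unfolding real_norm_def[symmetric] using compact_imp_bounded bounded_iff by (metis imageI)
  show ?thesis unfolding set_integrable_def
  proof (rule Bochner_Integration.integrable_bound)
    show "integrable lborel (\<lambda>y. B * (indicator {0..1} y *\<^sub>R g y))"
      using assms(1) unfolding set_integrable_def by auto
    have "(\<lambda>y. (indicator {0..1} y *\<^sub>R g y) * \<phi> y) \<in> borel_measurable lborel"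
      using assms by (intro borel_measurable_times)
        (auto simp: set_integrable_def intro: borel_measurable_continuous_onI)
    then show "(\<lambda>y. indicator {0..1} y *\<^sub>R (g y * \<phi> y)) \<in> borel_measurable lborel"
      by (simp add: mult.assoc)
    show "AE y in lborel. norm (indicator {0..1} y *\<^sub>R (g y * \<phi> y)) \<le> norm (B * (indicator {0..1} y *\<^sub>R g y))"
    proof (rule AE_I2)
      fix y
      have "\<bar>g y * \<phi> y\<bar> \<le> \<bar>B * g y\<bar>" if "y \<in> {0..1}"
        using mult_right_mono[OF B[OF that], of "\<bar>g y\<bar>"] abs_ge_self[of B]
          mult_right_mono[of B "\<bar>B\<bar>" "\<bar>g y\<bar>"]
        by (simp add: abs_mult mult.commute)
      then show "norm (indicator {0..1} y *\<^sub>R (g y * \<phi> y)) \<le> norm (B * (indicator {0..1} y *\<^sub>R g y))"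
        by (auto simp: indicator_def)
    qed
  qed
qed

text \<open>
  The weak equation only involves \<open>\<phi>'\<close>, so that any mean-zero \<open>\<psi>\<close> may stand in its place; for \<open>\<psi>\<close> of
  class \<open>C\<^sup>1\<close> the weak derivative of \<open>m\<close> can be moved onto \<open>\<psi>\<close> and disappears.
\<close>

lemma fokker_planck_mean_zero_test:
  assumes m: "continuous_on UNIV m" and u: "C1_torus u" "C1_torus (deriv u)"
    and fp: "fokker_planck P u m"
    and \<psi>: "\<And>y. (\<psi> has_real_derivative \<psi>' y) (at y)" "continuous_on UNIV \<psi>'" "periodic \<psi>" "mean \<psi> = 0"
  shows "mean (\<lambda>y. m y * \<psi>' y) = mean (\<lambda>y. m y * (deriv u y + P) * \<psi> y)"
proof -
  from fp obtain g where wd: "weak_deriv_torus m g"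
    and g: "\<And>\<phi>. C1_torus \<phi> \<Longrightarrow>
          (LINT y:{0..1}|lborel. (g y + m y * (deriv u y + P)) * deriv \<phi> y) = 0"
    unfolding fokker_planck_def by blast
  note cu = C1_torusD(4)[OF u(2)]
  have c\<psi>: "continuous_on UNIV \<psi>" using \<psi> DERIV_UNIV_continuous by blast
  obtain \<phi> where \<phi>: "\<And>y. (\<phi> has_real_derivative \<psi> y) (at y)" "periodic \<phi>"
    using periodic_antiderivative[OF c\<psi> \<psi>(3,4)] by metis
  have C1: "C1_torus \<phi>" "deriv \<phi> = \<psi>" using C1_torusI[OF \<phi>(1) c\<psi>] \<phi>(2) by auto
  have C1': "C1_torus \<psi>" "deriv \<psi> = \<psi>'" using C1_torusI[OF \<psi>(1,2)] \<psi>(3) by auto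
  have cont: "continuous_on UNIV (\<lambda>y. m y * (deriv u y + P) * \<psi> y)"
    using m cu c\<psi> by (intro continuous_intros)
  have si: "set_integrable lborel {0..1} (\<lambda>y. g y * \<psi> y)"
    using set_integrable_mult_continuous c\<psi> wd unfolding weak_deriv_torus_def by blast
  have "0 = (LINT y:{0..1}|lborel. g y * \<psi> y + m y * (deriv u y + P) * \<psi> y)"
    using g[OF C1(1)] unfolding C1(2) by (simp add: distrib_right)
  also have "\<dots> = (LINT y:{0..1}|lborel. g y * \<psi> y) + (LINT y:{0..1}|lborel. m y * (deriv u y + P) * \<psi> y)"
    by (intro set_integral_add si borel_integrable_atLeastAtMost' continuous_on_subset[OF cont]) auto
  also have "(LINT y:{0..1}|lborel. g y * \<psi> y) = - (LINT y:{0..1}|lborel. m y * \<psi>' y)"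
    using wd C1' unfolding weak_deriv_torus_def by force
  also have "(LINT y:{0..1}|lborel. m y * \<psi>' y) = mean (\<lambda>y. m y * \<psi>' y)"
    by (intro set_lint_eq_mean continuous_intros m \<psi>)
  also have "(LINT y:{0..1}|lborel. m y * (deriv u y + P) * \<psi> y) = mean (\<lambda>y. m y * (deriv u y + P) * \<psi> y)"
    by (intro set_lint_eq_mean cont)
  finally show ?thesis by simp
qed

text \<open>
  Du Bois-Reymond's argument. The right-hand side \<open>r\<close> has mean zero, hence a periodic primitive
  \<open>n\<close>; the weak equation makes \<open>m - n\<close> orthogonal to all mean-zero continuous functions, in
  particular to \<open>D = m - n - \<integral> (m - n)\<close>, so \<open>\<integral> D\<^sup>2 = 0\<close> and \<open>m\<close> inherits the regularity of \<open>n\<close>.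
\<close>

lemma fokker_planck_classical:
  assumes m: "continuous_on UNIV m" "periodic m" and u: "C1_torus u" "C1_torus (deriv u)"
    and fp: "fokker_planck P u m"
  shows "(m has_real_derivative
           mean (\<lambda>y. m y * (deriv u y + P)) - m y * (deriv u y + P)) (at y)"
proof -
  let ?w = "\<lambda>y. deriv u y + P" and ?c = "mean (\<lambda>y. m y * (deriv u y + P))"
  have w: "continuous_on UNIV ?w" "periodic ?w" "continuous_on UNIV (deriv u)"
    using C1_torusD(3,4)[OF u(2)] by (auto intro!: continuous_on_add)
  have cmw: "continuous_on UNIV (\<lambda>y. m y * ?w y)" using m w by (intro continuous_intros)
  define r where "r = (\<lambda>y. ?c - m y * ?w y)"
  have r: "continuous_on UNIV r" "periodic r" "mean r = 0"
    using m w mean_diff[OF continuous_on_const cmw, of ?c] cmw unfolding r_def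
    by (auto intro!: continuous_on_diff continuous_on_const)
  obtain n where n: "\<And>y. (n has_real_derivative r y) (at y)" "periodic n"
    using periodic_antiderivative[OF r] by metis
  have cn: "continuous_on UNIV n" using n DERIV_UNIV_continuous by blast
  define k where "k = mean (\<lambda>y. m y - n y)"
  define D where "D = (\<lambda>y. m y - n y - k)"
  have cmn: "continuous_on UNIV (\<lambda>y. m y - n y)" using m cn by (intro continuous_intros)
  have D: "continuous_on UNIV D" "periodic D" "mean D = 0"
    using m n cn cmn mean_diff[OF cmn continuous_on_const, of k] unfolding D_def k_def
    by (auto intro!: continuous_intros)
  obtain \<psi> where \<psi>: "\<And>y. (\<psi> has_real_derivative D y) (at y)" "periodic \<psi>" "mean \<psi> = 0"
    using periodic_antiderivative[OF D] by metis
  have c\<psi>: "continuous_on UNIV \<psi>" using \<psi> DERIV_UNIV_continuous by blast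
  have e1: "mean (\<lambda>y. m y * D y) = mean (\<lambda>y. m y * ?w y * \<psi> y)"
    by (rule fokker_planck_mean_zero_test[OF m(1) u fp \<psi>(1) D(1) \<psi>(2,3)])
  have "mean (\<lambda>y. n y * D y) = - mean (\<lambda>y. r y * \<psi> y)"
    by (rule mean_by_parts[OF n r(1) \<psi>(1,2) D(1)])
  also have "mean (\<lambda>y. r y * \<psi> y) = mean (\<lambda>y. ?c * \<psi> y - m y * ?w y * \<psi> y)"
    by (simp add: r_def algebra_simps)
  also have "\<dots> = mean (\<lambda>y. ?c * \<psi> y) - mean (\<lambda>y. m y * ?w y * \<psi> y)"
    using m w c\<psi> by (intro mean_diff continuous_intros)
  also have "mean (\<lambda>y. ?c * \<psi> y) = 0" using \<psi>(3) by simp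
  finally have e2: "mean (\<lambda>y. n y * D y) = mean (\<lambda>y. m y * ?w y * \<psi> y)" by simp
  have "mean (\<lambda>y. D y * D y) = mean (\<lambda>y. (m y * D y - n y * D y) - k * D y)"
    by (simp add: D_def algebra_simps)
  also have "\<dots> = mean (\<lambda>y. m y * D y - n y * D y) - mean (\<lambda>y. k * D y)"
    using m cn D by (intro mean_diff continuous_intros)
  also have "mean (\<lambda>y. m y * D y - n y * D y) = mean (\<lambda>y. m y * D y) - mean (\<lambda>y. n y * D y)"
    using m cn D by (intro mean_diff continuous_intros)
  also have "mean (\<lambda>y. k * D y) = 0" using D(3) by simp
  finally have "mean (\<lambda>y. D y * D y) = 0" using e1 e2 by simp
  then have "D y * D y = 0" for y
    using D by (intro mean_eq_0_imp[where f = "\<lambda>y. D y * D y"] continuous_intros) auto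
  then have "D y = 0" for y by simp
  then have "m = (\<lambda>y. n y + k)" by (auto simp: D_def fun_eq_iff algebra_simps)
  moreover have "((\<lambda>y. n y + k) has_real_derivative r y) (at y)"
    by (auto intro!: derivative_eq_intros n)
  ultimately show ?thesis by (simp add: r_def)
qed

section \<open>Uniqueness and the difference identity\<close>

text \<open>
  The cell problem in the unknowns \<open>w = u' + P\<close> and \<open>m\<close>, with classical derivatives. The mean in the
  last line is the constant flux \<open>m' + w m\<close>.
\<close>

definition profile ::
  "(real \<Rightarrow> real) \<Rightarrow> real \<Rightarrow> real \<Rightarrow> real \<Rightarrow> (real \<Rightarrow> real) \<Rightarrow> (real \<Rightarrow> real) \<Rightarrow> bool" where
  "profile v P \<alpha> h w m \<longleftrightarrow>
     periodic w \<and> periodic m \<and> mean w = P \<and> mean m = 1 \<and>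
     (\<forall>y. (w has_real_derivative (w y)\<^sup>2 / 2 - \<alpha> * m y - v y - h) (at y)) \<and>
     (\<forall>y. (m has_real_derivative mean (\<lambda>t. w t * m t) - w y * m y) (at y))"

lemma profile_continuous:
  assumes "profile v P \<alpha> h w m"
  shows "continuous_on UNIV w" "continuous_on UNIV m"
  using assms by (auto simp: profile_def intro: DERIV_UNIV_continuous)

lemma cell_solution_imp_profile:
  assumes "cell_solution v P \<alpha> h u m"
  shows "profile v P \<alpha> h (\<lambda>y. deriv u y + P) m"
proof -
  from assms have holder: "C2_holder_torus (1/2) u" and per: "periodic m" and cm: "continuous_on UNIV m"
    and hj: "\<And>y. - deriv (deriv u) y + 1/2 * (deriv u y + P)\<^sup>2 - \<alpha> * m y - v y = h"
    and fp: "fokker_planck P u m" and int: "(LINT y:{0..1}|lborel. m y) = 1"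
    unfolding cell_solution_def by (auto simp: periodic_fun_iff)
  from holder have u: "C1_torus u" "C1_torus (deriv u)" by (auto simp: C2_holder_torus_def)
  note u1 = C1_torusD[OF u(1)] and u2 = C1_torusD[OF u(2)]
  show ?thesis unfolding profile_def
  proof (intro conjI allI)
    fix y
    show "deriv u (y + 1) + P = deriv u y + P" using u2 by simp
    show "m (y + 1) = m y" using per by simp
    show "((\<lambda>y. deriv u y + P) has_real_derivative
       (deriv u y + P)\<^sup>2 / 2 - \<alpha> * m y - v y - h) (at y)"
    proof -
      have "((\<lambda>y. deriv u y + P) has_real_derivative deriv (deriv u) y) (at y)"
        by (auto intro!: derivative_eq_intros u2)
      moreover have "deriv (deriv u) y = (deriv u y + P)\<^sup>2 / 2 - \<alpha> * m y - v y - h"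
        using hj[of y] by simp
      ultimately show ?thesis by simp
    qed
    show "(m has_real_derivative
       mean (\<lambda>t. (deriv u t + P) * m t) - (deriv u y + P) * m y) (at y)"
      using fokker_planck_classical[OF cm per u fp, of y] by (simp add: mult.commute)
  next
    show "mean (\<lambda>y. deriv u y + P) = P"
      using mean_add[OF u2(4) continuous_on_const, of P] periodic_mean_deriv[of u "deriv u"] u1 by simp
    show "mean m = 1" using set_lint_eq_mean[OF cm] int by simp
  qed
qed

text \<open>
  If \<open>W' = w\<close>, then \<open>(e\<^sup>W m)' = c e\<^sup>W\<close> with the constant flux \<open>c\<close>, so \<open>e\<^sup>W m\<close> is monotone. As \<open>m\<close> has
  mean one, it is positive at some point; by monotonicity it stays positive on one side of it, and
  by periodicity it is positive everywhere.
\<close>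

lemma profile_positive:
  assumes "profile v P \<alpha> h w m"
  shows "0 < m y"
proof -
  from assms have w: "periodic w" and m: "periodic m" "mean m = 1"
    and dm: "\<And>y. (m has_real_derivative mean (\<lambda>t. w t * m t) - w y * m y) (at y)"
    by (auto simp: profile_def)
  define c where "c = mean (\<lambda>t. w t * m t)"
  obtain W where W: "\<And>y. (W has_real_derivative w y) (at y)"
    using antiderivative_exists profile_continuous[OF assms] by blast
  define E where "E = (\<lambda>y. exp (W y) * m y)"
  have E: "(E has_real_derivative c * exp (W y)) (at y)" for y
    unfolding E_def c_def
    by (rule derivative_eq_intros W dm refl)+ (simp add: algebra_simps)
  have "\<exists>z. 0 < m z"
  proof (rule ccontr)
    assume "\<not> ?thesis"
    then have "mean m \<le> mean (\<lambda>_. 0)"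
      using profile_continuous[OF assms] by (intro integral_le continuous_integrable) (auto simp: not_less)
    with m show False by simp
  qed
  then obtain z where z: "0 < m z" by blast
  interpret m: periodic_fun_simple' m using m by unfold_locales auto
  show ?thesis
  proof (cases "0 \<le> c")
    case True
    obtain n :: nat where n: "z - y \<le> real n" using real_arch_simple by blast
    have "E z \<le> E (y + real n)"
      by (rule DERIV_nonneg_imp_nondecreasing[OF _ exI]) (use n E True in auto)
    with z have "0 < E (y + real n)" unfolding E_def by (smt (verit) exp_gt_zero mult_pos_pos)
    then show ?thesis using m.plus_of_nat[of y n] by (simp add: E_def zero_less_mult_iff)
  next
    case False
    obtain n :: nat where n: "y - z \<le> real n" using real_arch_simple by blast
    have "E z \<le> E (y - real n)"
      by (rule DERIV_nonpos_imp_nonincreasing[OF _ exI]) 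
         (use n E False in \<open>auto simp: mult_le_0_iff\<close>)
    with z have "0 < E (y - real n)" unfolding E_def by (smt (verit) exp_gt_zero mult_pos_pos)
    then show ?thesis using m.minus_of_nat[of y n] by (simp add: E_def zero_less_mult_iff)
  qed
qed

text \<open>
  Integrating the derivative of the periodic function \<open>m\<^sub>1 (w\<^sub>1 - w\<^sub>2)\<close> over a period amounts to
  testing the difference of the two Hamilton-Jacobi equations with \<open>m\<^sub>1\<close>. The second
  solution may belong to another \<open>P\<close>, and this is what makes the identity useful for differentiating
  in \<open>P\<close>.
\<close>

lemma profile_difference:
  assumes 1: "profile v P1 \<alpha> h1 w1 m1" and 2: "profile v P2 \<alpha> h2 w2 m2"
  shows "h1 - h2 = mean (\<lambda>y. w1 y * m1 y) * (P1 - P2)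
           - mean (\<lambda>y. m1 y * (w1 y - w2 y)\<^sup>2) / 2 - \<alpha> * mean (\<lambda>y. m1 y * (m1 y - m2 y))"
proof -
  define c where "c = mean (\<lambda>y. w1 y * m1 y)"
  note [continuous_intros] = profile_continuous[OF 1] profile_continuous[OF 2]
  have d: "((\<lambda>y. m1 y * (w1 y - w2 y)) has_real_derivative
      (c - w1 y * m1 y) * (w1 y - w2 y)
      + m1 y * (((w1 y)\<^sup>2 / 2 - \<alpha> * m1 y - v y - h1) - ((w2 y)\<^sup>2 / 2 - \<alpha> * m2 y - v y - h2))) (at y)" for y
    using 1 2 unfolding profile_def c_def by (auto intro!: derivative_eq_intros)
  have "0 = mean (\<lambda>y. (c - w1 y * m1 y) * (w1 y - w2 y)
      + m1 y * (((w1 y)\<^sup>2 / 2 - \<alpha> * m1 y - v y - h1) - ((w2 y)\<^sup>2 / 2 - \<alpha> * m2 y - v y - h2)))"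
    using 1 2 by (intro periodic_mean_deriv[OF d, symmetric]) (auto simp: profile_def)
  also have "\<dots> = mean (\<lambda>y. (c * (w1 y - w2 y) - (h1 - h2) * m1 y)
      - (m1 y * (w1 y - w2 y)\<^sup>2 / 2 + \<alpha> * (m1 y * (m1 y - m2 y))))"
    by (intro arg_cong[where f = mean] ext) (simp add: power2_eq_square field_simps)
  also have "\<dots> = mean (\<lambda>y. c * (w1 y - w2 y) - (h1 - h2) * m1 y)
      - mean (\<lambda>y. m1 y * (w1 y - w2 y)\<^sup>2 / 2 + \<alpha> * (m1 y * (m1 y - m2 y)))"
    by (intro mean_diff continuous_intros) auto
  also have "mean (\<lambda>y. c * (w1 y - w2 y) - (h1 - h2) * m1 y)
      = mean (\<lambda>y. c * (w1 y - w2 y)) - mean (\<lambda>y. (h1 - h2) * m1 y)"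
    by (intro mean_diff continuous_intros)
  also have "mean (\<lambda>y. c * (w1 y - w2 y)) = c * (P1 - P2)"
    using mean_diff[OF profile_continuous(1)[OF 1] profile_continuous(1)[OF 2]] 1 2 by (simp add: profile_def)
  also have "mean (\<lambda>y. (h1 - h2) * m1 y) = h1 - h2" using 1 by (simp add: profile_def)
  also have "mean (\<lambda>y. m1 y * (w1 y - w2 y)\<^sup>2 / 2 + \<alpha> * (m1 y * (m1 y - m2 y)))
     = mean (\<lambda>y. m1 y * (w1 y - w2 y)\<^sup>2 / 2) + mean (\<lambda>y. \<alpha> * (m1 y * (m1 y - m2 y)))"
    by (intro mean_add continuous_intros) auto
  finally show ?thesis by (simp add: c_def)
qed

text \<open>
  For equal \<open>P\<close> the identity \<open>profile_difference\<close> and its mirror image add up to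
  \<open>\<integral> (m\<^sub>1 + m\<^sub>2) (w\<^sub>1 - w\<^sub>2)\<^sup>2 / 2 + \<alpha> \<integral> (m\<^sub>1 - m\<^sub>2)\<^sup>2 = 0\<close>, and both terms are nonnegative since the
  densities are positive.
\<close>

lemma profile_unique:
  assumes 1: "profile v P \<alpha> h1 w1 m1" and 2: "profile v P \<alpha> h2 w2 m2" and "0 < \<alpha>"
  shows "h1 = h2" "w1 = w2" "m1 = m2"
proof -
  note [continuous_intros] = profile_continuous[OF 1] profile_continuous[OF 2]
  note pos = profile_positive[OF 1] profile_positive[OF 2]
  define D where "D = (\<lambda>y. (m1 y * (w1 y - w2 y)\<^sup>2 + m2 y * (w2 y - w1 y)\<^sup>2) / 2 + \<alpha> * (m1 y - m2 y)\<^sup>2)"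
  have "mean D = mean (\<lambda>y. ((m1 y * (w1 y - w2 y)\<^sup>2 / 2 + \<alpha> * (m1 y * (m1 y - m2 y)))
     + (m2 y * (w2 y - w1 y)\<^sup>2 / 2 + \<alpha> * (m2 y * (m2 y - m1 y)))))"
    unfolding D_def by (intro arg_cong[where f = mean] ext) (simp add: power2_eq_square field_simps)
  also have "\<dots> = mean (\<lambda>y. m1 y * (w1 y - w2 y)\<^sup>2 / 2 + \<alpha> * (m1 y * (m1 y - m2 y)))
     + mean (\<lambda>y. m2 y * (w2 y - w1 y)\<^sup>2 / 2 + \<alpha> * (m2 y * (m2 y - m1 y)))"
    by (intro mean_add continuous_intros) auto
  also have "mean (\<lambda>y. m1 y * (w1 y - w2 y)\<^sup>2 / 2 + \<alpha> * (m1 y * (m1 y - m2 y)))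
     = mean (\<lambda>y. m1 y * (w1 y - w2 y)\<^sup>2 / 2) + mean (\<lambda>y. \<alpha> * (m1 y * (m1 y - m2 y)))"
    by (intro mean_add continuous_intros) auto
  also have "mean (\<lambda>y. m2 y * (w2 y - w1 y)\<^sup>2 / 2 + \<alpha> * (m2 y * (m2 y - m1 y)))
     = mean (\<lambda>y. m2 y * (w2 y - w1 y)\<^sup>2 / 2) + mean (\<lambda>y. \<alpha> * (m2 y * (m2 y - m1 y)))"
    by (intro mean_add continuous_intros) auto
  also have "mean (\<lambda>y. m1 y * (w1 y - w2 y)\<^sup>2 / 2) + mean (\<lambda>y. \<alpha> * (m1 y * (m1 y - m2 y))) +
     (mean (\<lambda>y. m2 y * (w2 y - w1 y)\<^sup>2 / 2) + mean (\<lambda>y. \<alpha> * (m2 y * (m2 y - m1 y)))) = 0"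
    using profile_difference[OF 1 2] profile_difference[OF 2 1] by simp
  finally have "mean D = 0" .
  then have D0: "D y = 0" for y
    by (rule mean_eq_0_imp[rotated 3])
       (use 1 2 pos assms(3) in \<open>auto simp: D_def profile_def less_imp_le intro!: continuous_intros\<close>)
  have eq: "w1 y = w2 y \<and> m1 y = m2 y" for y
  proof -
    have "0 \<le> m1 y * (w1 y - w2 y)\<^sup>2" "0 \<le> m2 y * (w2 y - w1 y)\<^sup>2" "0 \<le> \<alpha> * (m1 y - m2 y)\<^sup>2"
      using pos assms(3) by (auto simp: less_imp_le)
    moreover have "(m1 y * (w1 y - w2 y)\<^sup>2 + m2 y * (w2 y - w1 y)\<^sup>2) / 2 + \<alpha> * (m1 y - m2 y)\<^sup>2 = 0"
      using D0[of y] by (simp add: D_def)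
    ultimately have "m1 y * (w1 y - w2 y)\<^sup>2 = 0" "\<alpha> * (m1 y - m2 y)\<^sup>2 = 0"
      by argo+
    then show ?thesis using pos[of y] assms(3) by auto
  qed
  then show e: "w1 = w2" "m1 = m2" by auto
  show "h1 = h2" using profile_difference[OF 1 2] e by simp
qed

section \<open>Effective quantities from a classical solution\<close>

lemma cell_solution_eq:
  assumes "cell_solution v P \<alpha> h u m" "0 < \<alpha>"
  shows "Hbar v P \<alpha> = h" "bbar v P \<alpha> = mean (\<lambda>y. (deriv u y + P) * m y)"
proof -
  note p = cell_solution_imp_profile[OF assms(1)]
  have uniq: "h' = h \<and> (\<lambda>y. deriv u' y + P) = (\<lambda>y. deriv u y + P) \<and> m' = m"
    if "cell_solution v P \<alpha> h' u' m'" for h' u' m'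
    using profile_unique[OF cell_solution_imp_profile[OF that] p assms(2)] by blast
  show H: "Hbar v P \<alpha> = h" unfolding Hbar_def
    using assms(1) uniq by (intro the_equality) blast+
  have int: "(LINT y:{0..1}|lborel. (deriv u y + P) * m y) = mean (\<lambda>y. (deriv u y + P) * m y)"
    by (intro set_lint_eq_mean continuous_on_mult profile_continuous[OF p])
  show "bbar v P \<alpha> = mean (\<lambda>y. (deriv u y + P) * m y)" unfolding bbar_def H
  proof (rule the_equality)
    show "\<exists>u' m'. cell_solution v P \<alpha> h u' m' \<and> mean (\<lambda>y. (deriv u y + P) * m y)
       = (LINT y:{0..1}|lborel. (deriv u' y + P) * m' y)"
      using assms(1) int by metis
  next
    fix b assume "\<exists>u' m'. cell_solution v P \<alpha> h u' m' \<and> b = (LINT y:{0..1}|lborel. (deriv u' y + P) * m' y)"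
    then obtain u' m' where *: "cell_solution v P \<alpha> h u' m'"
      and b: "b = (LINT y:{0..1}|lborel. (deriv u' y + P) * m' y)" by blast
    from uniq[OF *] have "m' = m" "\<And>y. deriv u' y + P = deriv u y + P" by metis+
    then show "b = mean (\<lambda>y. (deriv u y + P) * m y)" using b int by simp
  qed
qed

lemma periodic_bounded:
  fixes f :: "real \<Rightarrow> real"
  assumes "continuous_on UNIV f" "periodic f"
  obtains B where "\<And>y. \<bar>f y\<bar> \<le> B"
proof -
  interpret periodic_fun_simple' f using assms by unfold_locales auto
  have "compact (f ` {0..1})" by (rule compact_continuous_image) (use assms continuous_on_subset[of UNIV f] in auto)
  then obtain B where B: "\<And>y. y \<in> {0..1} \<Longrightarrow> \<bar>f y\<bar> \<le> B"
    unfolding real_norm_def[symmetric] using compact_imp_bounded bounded_iff by (metis imageI)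
  have "\<bar>f y\<bar> \<le> B" for y
    using B[of "frac y"] minus_of_int[of y "\<lfloor>y\<rfloor>"] frac_lt_1[of y] by (simp add: frac_def)
  then show thesis using that by blast
qed

text \<open>
  At distance at most one the Lipschitz bound is stronger than the Hoelder bound, and at larger
  distances boundedness suffices.
\<close>

lemma C1_torus_holder:
  assumes "C1_torus f" "0 < \<gamma>" "\<gamma> < 1"
  shows "\<exists>C. \<forall>x y. \<bar>f x - f y\<bar> \<le> C * \<bar>x - y\<bar> powr \<gamma>"
proof -
  note f = C1_torusD[OF assms(1)]
  obtain B where B: "\<And>y. \<bar>f y\<bar> \<le> B" using periodic_bounded f by metis
  have "periodic (deriv f)" using deriv_periodic[OF f(1)] f(3) by blast
  then obtain L where L: "\<And>y. \<bar>deriv f y\<bar> \<le> L" using periodic_bounded f(2) by metis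
  have pos: "0 \<le> B" "0 \<le> L" using B[of 0] L[of 0] by linarith+
  have "\<bar>f x - f y\<bar> \<le> (L + 2 * B) * \<bar>x - y\<bar> powr \<gamma>" for x y
  proof (cases "\<bar>x - y\<bar> \<le> 1")
    case True
    have "norm (f x - f y) \<le> L * norm (x - y)"
      by (rule field_differentiable_bound[where S = UNIV and f' = "deriv f"])
         (use f L in \<open>auto intro: has_field_derivative_at_within\<close>)
    moreover have "\<bar>x - y\<bar> \<le> \<bar>x - y\<bar> powr \<gamma>"
      using powr_mono'[of \<gamma> 1 "\<bar>x - y\<bar>"] True assms by simp
    ultimately have "\<bar>f x - f y\<bar> \<le> L * \<bar>x - y\<bar> powr \<gamma>"
      using mult_left_mono[OF _ pos(2)] by (smt (verit) real_norm_def)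
    then show ?thesis using mult_right_mono[of L "L + 2 * B" "\<bar>x - y\<bar> powr \<gamma>"] pos by simp
  next
    case False
    have "1 \<le> \<bar>x - y\<bar> powr \<gamma>" using False assms by (intro ge_one_powr_ge_zero) auto
    then have "2 * B \<le> (L + 2 * B) * \<bar>x - y\<bar> powr \<gamma>"
      using mult_mono[of "2 * B" "L + 2 * B" 1 "\<bar>x - y\<bar> powr \<gamma>"] pos by simp
    moreover have "\<bar>f x - f y\<bar> \<le> 2 * B" using B[of x] B[of y] by linarith
    ultimately show ?thesis by linarith
  qed
  then show ?thesis by blast
qed

lemma continuous_set_integrable:
  fixes f :: "real \<Rightarrow> real"
  assumes "continuous_on UNIV f"
  shows "set_integrable lborel {0..1} f"
  by (intro borel_integrable_atLeastAtMost' continuous_on_subset[OF assms]) simp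

lemma continuous_Lp_torus:
  assumes "continuous_on UNIV f" "1 < p"
  shows "Lp_torus p f"
  unfolding Lp_torus_def
proof
  show "set_borel_measurable lborel {0..1} f"
    using continuous_set_integrable[OF assms(1)]
    unfolding set_integrable_def set_borel_measurable_def by (rule borel_measurable_integrable)
  show "set_integrable lborel {0..1} (\<lambda>y. \<bar>f y\<bar> powr p)"
    using assms by (intro continuous_set_integrable continuous_on_powr' continuous_intros) auto
qed

lemma C1_torus_weak_deriv:
  assumes "C1_torus f"
  shows "weak_deriv_torus f (deriv f)"
  unfolding weak_deriv_torus_def
proof (intro conjI allI impI continuous_set_integrable)
  note f = C1_torusD[OF assms]
  show "continuous_on UNIV f" "continuous_on UNIV (deriv f)" using f by auto
  fix \<phi> assume "C1_torus \<phi>"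
  note \<phi> = C1_torusD[OF this]
  have "(LINT y:{0..1}|lborel. f y * deriv \<phi> y) = mean (\<lambda>y. f y * deriv \<phi> y)"
    by (intro set_lint_eq_mean continuous_on_mult f \<phi>)
  moreover have "(LINT y:{0..1}|lborel. deriv f y * \<phi> y) = mean (\<lambda>y. deriv f y * \<phi> y)"
    by (intro set_lint_eq_mean continuous_on_mult f \<phi>)
  ultimately show "(LINT y:{0..1}|lborel. f y * deriv \<phi> y) = - (LINT y:{0..1}|lborel. deriv f y * \<phi> y)"
    using mean_by_parts[of f "deriv f" \<phi> "deriv \<phi>"] f \<phi> by simp
qed

text \<open>
  The equation expresses \<open>u'' = w'\<close> through \<open>w\<close>, \<open>m\<close> and \<open>v\<close>, all of class \<open>C\<^sup>1\<close>; this gives the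
  regularity required of \<open>u\<close>.
\<close>

lemma profile_imp_cell_solution:
  assumes v: "C1_torus v" and p: "profile v P \<alpha> h w m"
  obtains u where "cell_solution v P \<alpha> h u m" "\<And>y. deriv u y + P = w y"
proof -
  note v = C1_torusD[OF v]
  note cont = profile_continuous[OF p]
  define c where "c = mean (\<lambda>t. w t * m t)"
  define F where "F = (\<lambda>y. (w y)\<^sup>2 / 2 - \<alpha> * m y - v y - h)"
  from p have w: "periodic w" "mean w = P" "\<And>y. (w has_real_derivative F y) (at y)"
    and m: "periodic m" "mean m = 1" "\<And>y. (m has_real_derivative c - w y * m y) (at y)"
    by (auto simp: profile_def c_def F_def)
  have cF: "continuous_on UNIV F" unfolding F_def by (intro continuous_intros cont v) auto
  have F: "C1_torus F"
  proof (rule C1_torusI)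
    show "(F has_real_derivative w y * F y - \<alpha> * (c - w y * m y) - deriv v y) (at y)" for y
    proof -
      have "((\<lambda>y. (w y)\<^sup>2 / 2 - \<alpha> * m y - v y - h) has_real_derivative
          w y * F y - \<alpha> * (c - w y * m y) - deriv v y) (at y)"
        by (auto intro!: derivative_eq_intros w(3) m(3) v(1))
      then show ?thesis by (simp only: F_def[symmetric])
    qed
    show "continuous_on UNIV (\<lambda>y. w y * F y - \<alpha> * (c - w y * m y) - deriv v y)"
      by (intro continuous_intros cont cF v)
    show "F (y + 1) = F y" for y using w m v by (simp add: F_def)
  qed
  have cwP: "continuous_on UNIV (\<lambda>y. w y - P)" by (intro continuous_intros cont)
  have "mean (\<lambda>y. w y - P) = 0" using mean_diff[OF cont(1) continuous_on_const, of P] w by simp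
  then obtain u where u: "\<And>y. (u has_real_derivative w y - P) (at y)" "periodic u" "mean u = 0"
    using periodic_antiderivative[OF cwP] w(1) by auto
  have u1: "C1_torus u" and du: "deriv u = (\<lambda>y. w y - P)"
    using C1_torusI[OF u(1) cwP] u(2) by auto
  have d: "((\<lambda>y. w y - P) has_real_derivative F y) (at y)" for y
    by (auto intro!: derivative_eq_intros w)
  have u2: "C1_torus (\<lambda>y. w y - P)" and ddu: "deriv (\<lambda>y. w y - P) = F"
    using C1_torusI[OF d cF] w(1) by auto
  have cm': "continuous_on UNIV (\<lambda>y. c - w y * m y)" by (intro continuous_intros cont)
  have m1: "C1_torus m" and dm: "deriv m = (\<lambda>y. c - w y * m y)"
    using C1_torusI[OF m(3) cm'] m(1) by auto
  note wd = C1_torus_weak_deriv[OF m1, unfolded dm]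
  have fp: "fokker_planck P u m" unfolding fokker_planck_def
  proof (intro exI[of _ "\<lambda>y. c - w y * m y"] conjI allI impI wd)
    fix \<phi> assume "C1_torus \<phi>"
    note \<phi> = C1_torusD[OF this]
    have "mean (deriv \<phi>) = 0" using periodic_mean_deriv[OF \<phi>(1)] \<phi>(3) by blast
    then have "(LINT y:{0..1}|lborel. c * deriv \<phi> y) = 0"
      using set_lint_eq_mean[OF \<phi>(2)] by simp
    then show "(LINT y:{0..1}|lborel. (c - w y * m y + m y * (deriv u y + P)) * deriv \<phi> y) = 0"
      by (simp add: du mult.commute)
  qed
  have "cell_solution v P \<alpha> h u m" unfolding cell_solution_def
  proof (intro conjI allI impI fp cont)
    show "C2_holder_torus \<gamma> u" if "0 < \<gamma> \<and> \<gamma> < 1" for \<gamma>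
      unfolding C2_holder_torus_def du ddu using u1 u2 C1_torus_holder[OF F] that by blast
    show "periodic_fun_simple' m" using m(1) by (simp add: periodic_fun_iff)
    show "W1p_torus q m" if "1 < q" for q
      unfolding W1p_torus_def using wd continuous_Lp_torus[OF _ that] cont(2) cm' by blast
    show "- deriv (deriv u) y + 1/2 * (deriv u y + P)\<^sup>2 - \<alpha> * m y - v y = h" for y
      unfolding du ddu by (simp add: F_def)
    show "(LINT y:{0..1}|lborel. u y) = 0"
      using set_lint_eq_mean[OF C1_torusD(4)[OF u1]] u(3) by simp
    show "(LINT y:{0..1}|lborel. m y) = 1"
      using set_lint_eq_mean[OF cont(2)] m(2) by simp
  qed
  then show thesis using that du by simp
qed

lemma effective_eq:
  assumes "C1_torus v" "profile v P \<alpha> h w m" "0 < \<alpha>"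
  shows "Hbar v P \<alpha> = h" "bbar v P \<alpha> = mean (\<lambda>y. w y * m y)"
proof -
  obtain u where u: "cell_solution v P \<alpha> h u m" "\<And>y. deriv u y + P = w y"
    using profile_imp_cell_solution[OF assms(1,2)] by blast
  show "Hbar v P \<alpha> = h" "bbar v P \<alpha> = mean (\<lambda>y. w y * m y)"
    using cell_solution_eq[OF u(1) assms(3)] u(2) by simp_all
qed

section \<open>The mean-zero primitive as an operator\<close>

text \<open>
  Convolution with the sawtooth \<open>1/2 - t\<close>, which is the kernel of the mean-zero primitive of
  \<open>g - \<integral> g\<close> for periodic \<open>g\<close>. The formula makes sense for every bounded continuous function on the
  line, so the operator lives on the Banach space of all such functions and periodicity can be
  treated as a closed condition.
\<close>

definition osc_primitive :: "(real \<Rightarrow> real) \<Rightarrow> real \<Rightarrow> real" where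
  "osc_primitive g y = mean (\<lambda>t. (1/2 - t) * g (y - t))"

lemma continuous_on_shift:
  fixes g :: "real \<Rightarrow> real"
  assumes "continuous_on UNIV g"
  shows "continuous_on UNIV (\<lambda>t. g (y - t))"
  by (rule continuous_on_compose2[OF assms]) (auto intro!: continuous_intros)

lemma osc_primitive_bound:
  assumes "continuous_on UNIV g" "\<And>y. \<bar>g y\<bar> \<le> B"
  shows "\<bar>osc_primitive g y\<bar> \<le> B / 2"
proof -
  have "norm (mean (\<lambda>t. (1/2 - t) * g (y - t))) \<le> mean (\<lambda>t. B / 2)"
  proof (rule integral_norm_bound_integral)
    show "(\<lambda>t. (1/2 - t) * g (y - t)) integrable_on {0..1}"
      by (intro continuous_integrable continuous_intros continuous_on_shift assms)
    fix t :: real assume t: "t \<in> {0..1}"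
    have "\<bar>1/2 - t\<bar> \<le> 1/2" using t unfolding atLeastAtMost_iff by linarith
    then have "\<bar>1/2 - t\<bar> * \<bar>g (y - t)\<bar> \<le> 1/2 * B"
      using assms(2)[of "y - t"] by (intro mult_mono) auto
    then show "norm ((1/2 - t) * g (y - t)) \<le> B / 2" by (simp add: abs_mult)
  qed auto
  then show ?thesis by (simp add: osc_primitive_def)
qed

lemma osc_primitive_continuous:
  assumes "continuous_on UNIV g"
  shows "continuous_on UNIV (osc_primitive g)"
proof -
  have "continuous_on UNIV (\<lambda>y. integral (cbox 0 1) (\<lambda>t. (1/2 - t) * g (y - t)))"
    by (rule integral_continuous_on_param)
       (auto simp: split_beta intro!: continuous_intros continuous_on_compose2[OF assms])
  then show ?thesis by (simp add: osc_primitive_def[abs_def])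
qed

text \<open>
  One integration by parts against the kernel: its derivative \<open>-1\<close> produces the mean of \<open>F\<close>, which
  vanishes, and its two boundary values \<open>1/2\<close> and \<open>-1/2\<close> combine to \<open>F y\<close>.
\<close>

lemma osc_primitive_eq:
  assumes "\<And>y. (F has_real_derivative g y) (at y)" "periodic F" "mean F = 0" "continuous_on UNIV g"
  shows "osc_primitive g y = F y"
proof -
  have cF: "continuous_on UNIV F" using assms DERIV_UNIV_continuous by blast
  obtain G where G: "\<And>y. (G has_real_derivative F y) (at y)"
    using antiderivative_exists cF by blast
  have d: "((\<lambda>t. G (y - t) - (1/2 - t) * F (y - t)) has_real_derivative (1/2 - t) * g (y - t)) (at t)" for t
    by (auto intro!: derivative_eq_intros DERIV_chain2[OF G] DERIV_chain2[OF assms(1)])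
  have "osc_primitive g y = G (y - 1) + 1/2 * F (y - 1) - (G y - 1/2 * F y)"
    unfolding osc_primitive_def using mean_deriv[OF d] by simp
  also have "G y = G (y - 1)"
    using antiderivative_increment[OF G assms(2), of "y - 1"] assms(3) by simp
  also have "F (y - 1) = F y" using assms(2)[rule_format, of "y - 1"] by simp
  finally show ?thesis by simp
qed

text \<open>
  The kernel has mean zero, so \<open>g\<close> may be replaced by \<open>g - \<integral> g\<close>, which has a periodic primitive.
\<close>

lemma osc_primitive_deriv:
  assumes g: "continuous_on UNIV g" "periodic g"
  shows "(osc_primitive g has_real_derivative g y - mean g) (at y)"
    and "periodic (osc_primitive g)" and "mean (osc_primitive g) = 0"
proof -
  have c: "continuous_on UNIV (\<lambda>y. g y - mean g)" using g by (intro continuous_intros)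
  have "mean (\<lambda>y. g y - mean g) = 0" using mean_diff[OF g(1) continuous_on_const] by simp
  then obtain F where F: "\<And>y. (F has_real_derivative g y - mean g) (at y)" "periodic F" "mean F = 0"
    using periodic_antiderivative[OF c] g(2) by auto
  have "osc_primitive g z = F z" for z
  proof -
    have k: "((\<lambda>t::real. t / 2 - t\<^sup>2 / 2) has_real_derivative 1/2 - t) (at t)" for t
      by (auto intro!: derivative_eq_intros)
    have "osc_primitive g z = mean (\<lambda>t. (1/2 - t) * (g (z - t) - mean g) + (1/2 - t) * mean g)"
      unfolding osc_primitive_def by (intro arg_cong[where f = mean] ext) (simp add: algebra_simps)
    also have "\<dots> = mean (\<lambda>t. (1/2 - t) * (g (z - t) - mean g)) + mean (\<lambda>t. (1/2 - t) * mean g)"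
      by (intro mean_add continuous_intros continuous_on_shift g)
    also have "mean (\<lambda>t. (1/2 - t) * mean g) = 0"
      using mean_deriv[OF k] by simp
    also have "mean (\<lambda>t. (1/2 - t) * (g (z - t) - mean g)) = F z"
      using osc_primitive_eq[OF F c] by (simp add: osc_primitive_def)
    finally show ?thesis by simp
  qed
  then have "osc_primitive g = F" by blast
  then show "(osc_primitive g has_real_derivative g y - mean g) (at y)"
    "periodic (osc_primitive g)" "mean (osc_primitive g) = 0" using F by auto
qed

type_synonym cb = "real \<Rightarrow>\<^sub>C real"

lemma norm_apply_bcontfun: "\<bar>apply_bcontfun (f :: cb) y\<bar> \<le> norm f"
  using norm_bounded[of f y] by simp

definition bmult :: "cb \<Rightarrow> cb \<Rightarrow> cb" where
  "bmult f g = Bcontfun (\<lambda>y. f y * g y)"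

lemma bmult_apply [simp]: "bmult f g y = f y * g y"
proof -
  have "(\<lambda>y. f y * g y) \<in> bcontfun"
    by (rule bcontfun_normI[where b = "norm f * norm g"])
       (auto simp: abs_mult norm_apply_bcontfun intro!: continuous_intros mult_mono)
  then show ?thesis by (simp add: bmult_def Bcontfun_inverse)
qed

definition J :: "cb \<Rightarrow> cb" where
  "J g = Bcontfun (osc_primitive g)"

lemma J_apply [simp]: "J g y = osc_primitive g y"
proof -
  have "osc_primitive g \<in> bcontfun"
    using osc_primitive_bound[OF _ norm_apply_bcontfun, of g]
    by (intro bcontfun_normI[where b = "norm g / 2"]) (auto intro!: osc_primitive_continuous)
  then show ?thesis by (simp add: J_def Bcontfun_inverse)
qed

lemma bounded_bilinear_bmult: "bounded_bilinear bmult"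
proof
  fix a a' b b' :: cb and r :: real
  show "bmult (a + a') b = bmult a b + bmult a' b" by (rule bcontfun_eqI) (simp add: algebra_simps)
  show "bmult a (b + b') = bmult a b + bmult a b'" by (rule bcontfun_eqI) (simp add: algebra_simps)
  show "bmult (r *\<^sub>R a) b = r *\<^sub>R bmult a b" by (rule bcontfun_eqI) simp
  show "bmult a (r *\<^sub>R b) = r *\<^sub>R bmult a b" by (rule bcontfun_eqI) simp
  show "\<exists>K. \<forall>a b. norm (bmult a b) \<le> norm a * norm b * K"
    by (intro exI[of _ 1] allI norm_bound)
       (simp add: abs_mult mult_mono norm_apply_bcontfun)
qed

lemma norm_bmult: "norm (bmult a b) \<le> norm a * norm b"
  by (rule norm_bound) (simp add: abs_mult mult_mono norm_apply_bcontfun)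

lemma norm_J: "norm (J g) \<le> norm g / 2"
  using osc_primitive_bound[OF _ norm_apply_bcontfun, of g] by (intro norm_bound) simp

lemma bounded_linear_J: "bounded_linear J"
proof
  fix a b :: cb and r :: real
  show "J (a + b) = J a + J b"
    by (rule bcontfun_eqI)
       (auto simp: osc_primitive_def distrib_left intro!: mean_add continuous_intros continuous_on_shift)
  show "J (r *\<^sub>R a) = r *\<^sub>R J a"
    by (rule bcontfun_eqI) (simp add: osc_primitive_def mult.left_commute)
  show "\<exists>K. \<forall>x. norm (J x) \<le> norm x * K" using norm_J by (intro exI[of _ "1/2"]) simp
qed

definition bmean :: "cb \<Rightarrow> real" where "bmean f = mean f"

lemma bounded_linear_bmean: "bounded_linear bmean"
  and bmean_bound: "\<bar>bmean f\<bar> \<le> norm f"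
proof -
  have bound: "\<bar>bmean f\<bar> \<le> norm f" for f
  proof -
    have "norm (mean f) \<le> mean (\<lambda>_. norm f)"
      by (rule integral_norm_bound_integral) (auto simp: norm_apply_bcontfun)
    then show ?thesis by (simp add: bmean_def)
  qed
  show "bounded_linear bmean"
    by standard (use bound in \<open>auto simp: bmean_def mean_add intro!: exI[of _ 1]\<close>)
  show "\<bar>bmean f\<bar> \<le> norm f" by (rule bound)
qed

section \<open>Quadratic perturbations of a contraction\<close>

text \<open>
  The constants balance as follows: for \<open>|p| \<le> 1/4\<close> and on the ball of radius \<open>1/16\<close> the linear and
  quadratic parts have Lipschitz constants \<open>1/2 + 1/8\<close> and \<open>2/16\<close>, together \<open>3/4 < 1\<close>, and the ball
  is mapped into itself as \<open>3/4 * 1/16 + 1/64 = 1/16\<close>.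
\<close>

locale quadratic_perturbation =
  fixes A B :: "'a::{real_normed_vector, complete_space} \<Rightarrow> 'a" and Q :: "'a \<Rightarrow> 'a \<Rightarrow> 'a" and z :: 'a
  assumes A: "bounded_linear A" and B: "bounded_linear B" and Q: "bounded_bilinear Q"
    and norm_A: "norm (A x) \<le> norm x / 2" and norm_B: "norm (B x) \<le> norm x / 2"
    and norm_Q: "norm (Q x y) \<le> norm x * norm y"
    and norm_z: "norm z \<le> 1/64"
begin

definition T :: "real \<Rightarrow> 'a \<Rightarrow> 'a" where
  "T p x = A x + p *\<^sub>R B x + Q x x + z"

definition branch :: "real \<Rightarrow> 'a \<Rightarrow> bool" where
  "branch p x \<longleftrightarrow> norm x \<le> 1/16 \<and> T p x = x"

lemma linearised_bound:
  assumes "\<bar>p\<bar> \<le> 1/4" "norm x \<le> 1/16" "norm y \<le> 1/16"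
  shows "norm (A d + p *\<^sub>R B d + Q d x + Q y d) \<le> 3/4 * norm d"
proof -
  have "norm (A d + p *\<^sub>R B d + Q d x + Q y d) \<le> norm (A d) + norm (p *\<^sub>R B d) + norm (Q d x) + norm (Q y d)"
    by (intro norm_triangle_le add_mono norm_triangle_ineq order.refl)
  moreover have "norm (p *\<^sub>R B d) \<le> 1/4 * (norm d / 2)"
    unfolding norm_scaleR using assms(1) norm_B by (intro mult_mono) auto
  moreover have "norm (Q d x) \<le> norm d * (1/16)"
    using norm_Q[of d x] mult_left_mono[OF assms(2), of "norm d"] by simp
  moreover have "norm (Q y d) \<le> (1/16) * norm d"
    using norm_Q[of y d] mult_right_mono[OF assms(3), of "norm d"] by simp
  ultimately show ?thesis using norm_A[of d] by linarith
qed

lemma T_diff: "T p x - T p y = A (x - y) + p *\<^sub>R B (x - y) + Q (x - y) x + Q y (x - y)"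
  by (simp add: T_def bounded_linear.linear[OF A, THEN linear_diff] bounded_linear.linear[OF B, THEN linear_diff]
      bounded_bilinear.diff_left[OF Q] bounded_bilinear.diff_right[OF Q] scaleR_diff_right)

text \<open>
  The closed set \<open>V\<close> serves to find the fixed point among the periodic functions.
\<close>

lemma branch_exists:
  assumes p: "\<bar>p\<bar> \<le> 1/4" and V: "closed V" "0 \<in> V" "\<And>x. x \<in> V \<Longrightarrow> T p x \<in> V"
  obtains x where "x \<in> V" "branch p x"
proof -
  let ?S = "V \<inter> cball 0 (1/16)"
  have T0: "T p 0 = z"
    by (simp add: T_def linear_simps(3)[OF A] linear_simps(3)[OF B] bounded_bilinear.zero_left[OF Q])
  have lip: "norm (T p x - T p y) \<le> 3/4 * norm (x - y)" if "x \<in> ?S" "y \<in> ?S" for x y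
    unfolding T_diff by (rule linearised_bound) (use that p in auto)
  have self: "T p x \<in> ?S" if x: "x \<in> ?S" for x
  proof -
    have "norm (A x + p *\<^sub>R B x + Q x x + Q 0 x) \<le> 3/4 * norm x"
      by (rule linearised_bound) (use x p in auto)
    then have "norm (T p x - z) \<le> 3/4 * (1/16)"
      using x by (simp add: T_def bounded_bilinear.zero_left[OF Q])
    then have "norm (T p x) \<le> 1/16" using norm_z norm_triangle_sub[of "T p x" z] by simp
    then show ?thesis using V x by simp
  qed
  have "\<exists>!x. x \<in> ?S \<and> T p x = x"
  proof (rule Banach_fix)
    show "complete ?S" using V by (simp add: complete_eq_closed closed_Int)
    show "?S \<noteq> {}" using V by auto
    show "(0::real) \<le> 3/4" "(3/4::real) < 1" by auto
    show "T p ` ?S \<subseteq> ?S" using self by blast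
    show "dist (T p x) (T p y) \<le> 3/4 * dist x y" if "x \<in> ?S" "y \<in> ?S" for x y
      using lip[OF that] by (simp add: dist_norm)
  qed
  then show thesis using that by (auto simp: branch_def)
qed

lemma branch_norm:
  assumes "\<bar>p\<bar> \<le> 1/4" "branch p x"
  shows "norm x \<le> 4 * norm z"
proof -
  have "norm (A x + p *\<^sub>R B x + Q x x + Q 0 x) \<le> 3/4 * norm x"
    by (rule linearised_bound) (use assms in \<open>auto simp: branch_def\<close>)
  then have "norm (x - z) \<le> 3/4 * norm x"
    using assms by (metis (no_types) branch_def T_def bounded_bilinear.zero_left[OF Q] add_0_right add_diff_cancel_right')
  then show ?thesis using norm_triangle_sub[of x z] by simp
qed

lemma branch_linear_approx:
  assumes p: "\<bar>p\<bar> \<le> 1/4" and x: "branch p x" and y: "y = A y + p *\<^sub>R B y + z"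
  shows "norm (x - y) \<le> 4 * (norm x)\<^sup>2"
proof -
  let ?d = "x - y"
  have "?d = (A x + p *\<^sub>R B x + Q x x + z) - (A y + p *\<^sub>R B y + z)"
    using x y by (simp add: branch_def T_def)
  also have "\<dots> = (A ?d + p *\<^sub>R B ?d + Q ?d 0 + Q 0 ?d) + Q x x"
    by (simp add: bounded_linear.linear[OF A, THEN linear_diff] bounded_linear.linear[OF B, THEN linear_diff]
        bounded_bilinear.zero_left[OF Q] bounded_bilinear.zero_right[OF Q] scaleR_diff_right)
  finally have "norm ?d \<le> norm (A ?d + p *\<^sub>R B ?d + Q ?d 0 + Q 0 ?d) + norm (Q x x)"
    using norm_triangle_ineq by metis
  moreover have "norm (A ?d + p *\<^sub>R B ?d + Q ?d 0 + Q 0 ?d) \<le> 3/4 * norm ?d"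
    by (rule linearised_bound[OF p]) auto
  moreover have "norm (Q x x) \<le> (norm x)\<^sup>2" using norm_Q[of x x] by (simp add: power2_eq_square)
  ultimately show ?thesis by simp
qed

text \<open>
  The candidate \<open>D\<close> for the derivative solves the linearised equation \<open>D = M D + B x\<close>, which has a
  solution since \<open>M\<close> is a contraction. The increment \<open>d = X q - X p\<close> is of order \<open>q - p\<close>, and the
  error \<open>d - (q - p) D\<close> satisfies the same linear equation with a right-hand side of order
  \<open>(q - p)\<^sup>2\<close>.
\<close>

lemma branch_differentiable:
  assumes X: "\<And>q. \<bar>q\<bar> \<le> 1/4 \<Longrightarrow> branch q (X q)" and p: "\<bar>p\<bar> < 1/4"
  shows "\<exists>D. (X has_vector_derivative D) (at p)"
proof -
  note lin = linear_simps(1,2,5)[OF A] linear_simps(1,2,5)[OF B]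
    bounded_bilinear.add_left[OF Q] bounded_bilinear.add_right[OF Q]
    bounded_bilinear.diff_left[OF Q] bounded_bilinear.diff_right[OF Q]
    bounded_bilinear.scaleR_left[OF Q] bounded_bilinear.scaleR_right[OF Q]
  define x where "x = X p"
  define M where "M = (\<lambda>d. A d + p *\<^sub>R B d + Q d x + Q x d)"
  have x: "norm x \<le> 1/16" "T p x = x" using X[of p] p by (auto simp: x_def branch_def)
  have M: "norm (M d) \<le> 3/4 * norm d" for d
    unfolding M_def by (rule linearised_bound) (use x p in auto)
  have M_diff: "M a - M b = M (a - b)" for a b
    by (simp add: M_def lin scaleR_diff_right)
  have M_scale: "M (r *\<^sub>R a) = r *\<^sub>R M a" for r a
    by (simp add: M_def lin scaleR_add_right scaleR_left_commute)
  have "\<exists>!d. M d + B x = d"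
  proof (rule banach_fix_type)
    show "\<forall>a b. dist (M a + B x) (M b + B x) \<le> 3/4 * dist a b"
      using M by (simp add: dist_norm M_diff)
  qed auto
  then obtain D where D: "M D + B x = D" by blast
  have err: "norm (X q - X p - (q - p) *\<^sub>R D) \<le> \<bar>q - p\<bar>\<^sup>2" if q: "\<bar>q\<bar> \<le> 1/4" for q
  proof -
    let ?d = "X q - x"
    have Xq: "norm (X q) \<le> 1/16" "T q (X q) = X q" using X[OF q] by (auto simp: branch_def)
    have "?d = (T p (X q) - T p x) + (q - p) *\<^sub>R B (X q)"
      using x Xq by (simp add: T_def scaleR_diff_left algebra_simps)
    then have d1: "?d = (A ?d + p *\<^sub>R B ?d + Q ?d (X q) + Q x ?d) + (q - p) *\<^sub>R B (X q)"
      by (simp only: T_diff)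
    have "norm (A ?d + p *\<^sub>R B ?d + Q ?d (X q) + Q x ?d) \<le> 3/4 * norm ?d"
      by (rule linearised_bound) (use x Xq p in auto)
    moreover have "norm ((q - p) *\<^sub>R B (X q)) \<le> \<bar>q - p\<bar> * (1/32)"
      unfolding norm_scaleR using norm_B[of "X q"] Xq by (intro mult_left_mono) auto
    moreover have "norm ?d \<le> norm (A ?d + p *\<^sub>R B ?d + Q ?d (X q) + Q x ?d) + norm ((q - p) *\<^sub>R B (X q))"
      using d1 norm_triangle_ineq by metis
    ultimately have nd: "norm ?d \<le> \<bar>q - p\<bar> / 8" by simp
    let ?e = "?d - (q - p) *\<^sub>R D"
    have d2: "?d = M ?d + Q ?d ?d + (q - p) *\<^sub>R B x + (q - p) *\<^sub>R B ?d"
      using d1 by (simp add: M_def lin scaleR_diff_right algebra_simps)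
    have "(q - p) *\<^sub>R D = M ((q - p) *\<^sub>R D) + (q - p) *\<^sub>R B x"
      using arg_cong[OF D, of "(*\<^sub>R) (q - p)"] by (simp add: M_scale scaleR_add_right)
    with d2 have "?e = (M ?d + Q ?d ?d + (q - p) *\<^sub>R B x + (q - p) *\<^sub>R B ?d)
        - (M ((q - p) *\<^sub>R D) + (q - p) *\<^sub>R B x)" by metis
    also have "\<dots> = M ?e + (Q ?d ?d + (q - p) *\<^sub>R B ?d)"
      by (simp add: M_diff[symmetric])
    finally have "norm ?e \<le> norm (M ?e) + norm (Q ?d ?d + (q - p) *\<^sub>R B ?d)"
      using norm_triangle_ineq by metis
    moreover have "norm (Q ?d ?d + (q - p) *\<^sub>R B ?d) \<le> norm (Q ?d ?d) + norm ((q - p) *\<^sub>R B ?d)"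
      by (rule norm_triangle_ineq)
    moreover have "norm (Q ?d ?d) \<le> \<bar>q - p\<bar> / 8 * (\<bar>q - p\<bar> / 8)"
      using norm_Q[of ?d ?d] mult_mono[OF nd nd] by simp
    moreover have "norm ((q - p) *\<^sub>R B ?d) \<le> \<bar>q - p\<bar> * (\<bar>q - p\<bar> / 16)"
      unfolding norm_scaleR using norm_B[of ?d] nd by (intro mult_left_mono) auto
    ultimately have "norm ?e \<le> 3/4 * norm ?e + (\<bar>q - p\<bar> / 8 * (\<bar>q - p\<bar> / 8) + \<bar>q - p\<bar> * (\<bar>q - p\<bar> / 16))"
      using M[of ?e] by linarith
    then have "norm ?e \<le> 5/16 * (\<bar>q - p\<bar> * \<bar>q - p\<bar>)" by simp
    also have "\<dots> \<le> \<bar>q - p\<bar>\<^sup>2" by (simp add: power2_eq_square)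
    finally show ?thesis by (simp add: x_def)
  qed
  have "(X has_derivative (\<lambda>h. h *\<^sub>R D)) (at p)"
  proof (rule has_derivativeI_sandwich[where e = "1/4 - \<bar>p\<bar>" and H = "\<lambda>q. \<bar>q - p\<bar>"])
    show "((\<lambda>q. \<bar>q - p\<bar>) \<longlongrightarrow> 0) (at p)"
      by (rule tendsto_eq_intros refl | simp)+
    fix q assume "q \<noteq> p" "dist q p < 1/4 - \<bar>p\<bar>"
    then have "norm (X q - X p - (q - p) *\<^sub>R D) \<le> \<bar>q - p\<bar>\<^sup>2"
      by (intro err) (auto simp: dist_real_def)
    then show "norm (X q - X p - (q - p) *\<^sub>R D) / norm (q - p) \<le> \<bar>q - p\<bar>"
      using \<open>q \<noteq> p\<close> by (simp add: divide_le_eq power2_eq_square)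
  qed (use p in \<open>auto intro: bounded_linear_scaleR_left\<close>)
  then show ?thesis unfolding has_vector_derivative_def by blast
qed

end

section \<open>The cell problem as a fixed-point equation\<close>

text \<open>
  The operators of the fixed-point equation for \<open>x = (\<mu>, \<omega>)\<close>, where \<open>m = 1 + \<mu>\<close>, \<open>w = p + \<omega>\<close> and
  \<open>\<alpha> = 1\<close>. Up to constants, the two equations read \<open>\<mu>' = - \<omega> - p \<mu> - \<mu> \<omega>\<close> and
  \<open>\<omega>' = - \<mu> + p \<omega> + \<omega>\<^sup>2/2 - v\<close>; \<open>J\<close> inverts the derivative and removes the constants, which are
  the unknown flux and the unknown effective Hamiltonian.
\<close>

definition opA :: "cb \<times> cb \<Rightarrow> cb \<times> cb" where
  "opA x = (- J (snd x), - J (fst x))"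

definition opB :: "cb \<times> cb \<Rightarrow> cb \<times> cb" where
  "opB x = (- J (fst x), J (snd x))"

definition opQ :: "cb \<times> cb \<Rightarrow> cb \<times> cb \<Rightarrow> cb \<times> cb" where
  "opQ x y = (- J (bmult (fst x) (snd y)), (1/2) *\<^sub>R J (bmult (snd x) (snd y)))"

lemmas J_simps = linear_simps(1,2,3,4,5)[OF bounded_linear_J]
lemmas bmult_simps = bounded_bilinear.add_left[OF bounded_bilinear_bmult] bounded_bilinear.add_right[OF bounded_bilinear_bmult]
  bounded_bilinear.scaleR_left[OF bounded_bilinear_bmult] bounded_bilinear.scaleR_right[OF bounded_bilinear_bmult]

lemma norm_Pair_half:
  fixes a b c d :: cb
  assumes "norm a \<le> norm c / 2" "norm b \<le> norm d / 2"
  shows "norm (a, b) \<le> norm (c, d) / 2"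
proof -
  have "norm (a, b) \<le> norm (norm c / 2, norm d / 2)"
    unfolding norm_Pair using assms
    by (intro real_sqrt_le_mono add_mono power_mono) auto
  also have "(norm c / 2, norm d / 2) = (1/2) *\<^sub>R (norm c, norm d)" by simp
  also have "norm \<dots> = norm (c, d) / 2" by (simp only: norm_scaleR) (simp add: norm_Pair)
  finally show ?thesis .
qed

lemma opQ_norm: "norm (opQ x y) \<le> norm x * norm y"
proof -
  have le: "norm (fst x) \<le> norm x" "norm (snd x) \<le> norm x" "norm (snd y) \<le> norm y"
    using norm_fst_le[of "fst x" "snd x"] norm_snd_le[of "snd x" "fst x"] norm_snd_le[of "snd y" "fst y"] by simp_all
  have 1: "norm (J (bmult (fst x) (snd y))) \<le> norm x * norm y / 2"
    using norm_J[of "bmult (fst x) (snd y)"] norm_bmult[of "fst x" "snd y"] mult_mono[OF le(1,3)] by simp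
  have 2: "norm (J (bmult (snd x) (snd y))) \<le> norm x * norm y / 2"
    using norm_J[of "bmult (snd x) (snd y)"] norm_bmult[of "snd x" "snd y"] mult_mono[OF le(2,3)] by simp
  have "norm (opQ x y) \<le> norm (J (bmult (fst x) (snd y))) + norm (J (bmult (snd x) (snd y))) / 2"
    unfolding opQ_def using norm_Pair_le by (rule order_trans) simp
  moreover have "0 \<le> norm x * norm y" by simp
  ultimately show ?thesis using 1 2 by linarith
qed

lemma quadratic_perturbation_torus:
  assumes "norm z \<le> 1/64"
  shows "quadratic_perturbation opA opB opQ z"
proof (rule quadratic_perturbation.intro)
  show "bounded_linear opA" unfolding opA_def[abs_def]
    by (intro bounded_linear_Pair bounded_linear_minus bounded_linear_compose[OF bounded_linear_J]
        bounded_linear_fst bounded_linear_snd)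
  show "bounded_linear opB" unfolding opB_def[abs_def]
    by (intro bounded_linear_Pair bounded_linear_minus bounded_linear_compose[OF bounded_linear_J]
        bounded_linear_fst bounded_linear_snd)
  show "bounded_bilinear opQ"
  proof
    show "\<exists>K. \<forall>a b. norm (opQ a b) \<le> norm a * norm b * K"
      using opQ_norm by (intro exI[of _ 1]) simp
  qed (auto simp: opQ_def bmult_simps J_simps scaleR_add_right)
  show "norm (opA x) \<le> norm x / 2" for x
    using norm_Pair_half[of "- J (snd x)" "snd x" "- J (fst x)" "fst x"] norm_J[of "fst x"] norm_J[of "snd x"]
    by (simp add: opA_def norm_Pair norm_prod_def add.commute)
  show "norm (opB x) \<le> norm x / 2" for x
    using norm_Pair_half[of "- J (fst x)" "fst x" "J (snd x)" "snd x"] norm_J[of "fst x"] norm_J[of "snd x"]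
    by (simp add: opB_def)
  show "norm (opQ x y) \<le> norm x * norm y" for x y by (rule opQ_norm)
  show "norm z \<le> 1/64" by fact
qed

lemma bounded_linear_eval: "bounded_linear (\<lambda>f :: cb. f y)"
  by (rule bounded_linear_intro[where K = 1]) (auto simp: norm_apply_bcontfun)

definition periodic_pairs :: "(cb \<times> cb) set" where
  "periodic_pairs = {x. \<forall>y. apply_bcontfun (fst x) (y + 1) = apply_bcontfun (fst x) y \<and>
                          apply_bcontfun (snd x) (y + 1) = apply_bcontfun (snd x) y}"

lemma closed_periodic_pairs: "closed periodic_pairs"
  unfolding periodic_pairs_def
  by (intro closed_Collect_conj closed_Collect_all closed_Collect_eq
      bounded_linear.continuous_on[OF bounded_linear_eval] continuous_on_fst continuous_on_snd continuous_on_id)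

lemma J_periodic:
  fixes g :: cb
  shows "periodic g \<Longrightarrow> periodic (J g)"
  using osc_primitive_deriv(2)[of g] by simp

text \<open>
  The constants removed by \<open>J\<close> are recovered as means: they give the effective Hamiltonian and the
  flux.
\<close>

lemma profile_of_fixed_point:
  fixes f \<mu> \<omega> :: cb
  assumes f: "periodic f" "bmean f = 0" and x: "periodic \<mu>" "periodic \<omega>"
    and fix1: "opA (\<mu>, \<omega>) + p *\<^sub>R opB (\<mu>, \<omega>) + opQ (\<mu>, \<omega>) (\<mu>, \<omega>) + (0, - J f) = (\<mu>, \<omega>)"
  shows "profile (\<lambda>y. k + f y) p 1 (p\<^sup>2/2 - 1 + bmean (bmult \<omega> \<omega>) / 2 - k) (\<lambda>y. p + \<omega> y) (\<lambda>y. 1 + \<mu> y)"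
    and "bmean \<mu> = 0" and "mean (\<lambda>y. (p + \<omega> y) * (1 + \<mu> y)) = p + bmean (bmult \<mu> \<omega>)"
proof -
  note bmean_simps = linear_simps(1,2,3,4,5)[OF bounded_linear_bmean]
  define g1 where "g1 = - (\<omega> + p *\<^sub>R \<mu> + bmult \<mu> \<omega>)"
  define g2 where "g2 = p *\<^sub>R \<omega> - \<mu> + (1/2) *\<^sub>R bmult \<omega> \<omega> - f"
  have "\<mu> = J g1" and "\<omega> = J g2"
    using fix1 by (auto simp: opA_def opB_def opQ_def g1_def g2_def J_simps algebra_simps)
  then have eq: "apply_bcontfun \<mu> = osc_primitive g1" "apply_bcontfun \<omega> = osc_primitive g2"
    by (auto simp: fun_eq_iff)
  have per: "periodic g1" "periodic g2" using f x by (auto simp: g1_def g2_def)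
  have \<mu>: "(\<mu> has_real_derivative g1 y - bmean g1) (at y)" "mean \<mu> = 0" for y
    unfolding eq bmean_def using per by (intro osc_primitive_deriv; simp)+
  have \<omega>: "(\<omega> has_real_derivative g2 y - bmean g2) (at y)" "mean \<omega> = 0" for y
    unfolding eq bmean_def using per by (intro osc_primitive_deriv; simp)+
  show m0: "bmean \<mu> = 0" using \<mu> by (simp add: bmean_def)
  have m0': "bmean \<omega> = 0" using \<omega> by (simp add: bmean_def)
  have b1: "bmean g1 = - bmean (bmult \<mu> \<omega>)" using m0 m0' by (simp add: g1_def bmean_simps)
  have b2: "bmean g2 = bmean (bmult \<omega> \<omega>) / 2" using m0 m0' f by (simp add: g2_def bmean_simps)
  have "mean (\<lambda>y. (p + \<omega> y) * (1 + \<mu> y)) = bmean (const_bcontfun p + p *\<^sub>R \<mu> + \<omega> + bmult \<mu> \<omega>)"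
    unfolding bmean_def by (intro arg_cong[where f = mean] ext) (simp add: algebra_simps const_bcontfun.rep_eq)
  also have "\<dots> = p + bmean (bmult \<mu> \<omega>)"
    using m0 m0' by (simp add: bmean_simps) (simp add: bmean_def const_bcontfun.rep_eq)
  finally show c: "mean (\<lambda>y. (p + \<omega> y) * (1 + \<mu> y)) = p + bmean (bmult \<mu> \<omega>)" .
  show "profile (\<lambda>y. k + f y) p 1 (p\<^sup>2/2 - 1 + bmean (bmult \<omega> \<omega>) / 2 - k) (\<lambda>y. p + \<omega> y) (\<lambda>y. 1 + \<mu> y)"
    unfolding profile_def c
  proof (intro conjI allI)
    fix y
    show "p + \<omega> (y + 1) = p + \<omega> y" "1 + \<mu> (y + 1) = 1 + \<mu> y" using x by auto
    have "((\<lambda>y. p + \<omega> y) has_real_derivative g2 y - bmean g2) (at y)"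
      by (auto intro!: derivative_eq_intros \<omega>)
    moreover have "g2 y - bmean g2 = (p + \<omega> y)\<^sup>2 / 2 - 1 * (1 + \<mu> y) - (k + f y) -
        (p\<^sup>2 / 2 - 1 + bmean (bmult \<omega> \<omega>) / 2 - k)"
      unfolding b2 by (simp add: g2_def power2_eq_square field_simps)
    ultimately show "((\<lambda>y. p + \<omega> y) has_real_derivative (p + \<omega> y)\<^sup>2 / 2 - 1 * (1 + \<mu> y) - (k + f y) -
        (p\<^sup>2 / 2 - 1 + bmean (bmult \<omega> \<omega>) / 2 - k)) (at y)" by simp
    have "((\<lambda>y. 1 + \<mu> y) has_real_derivative g1 y - bmean g1) (at y)"
      by (auto intro!: derivative_eq_intros \<mu>)
    moreover have "g1 y - bmean g1 = p + bmean (bmult \<mu> \<omega>) - (p + \<omega> y) * (1 + \<mu> y)"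
      unfolding b1 by (simp add: g1_def algebra_simps)
    ultimately show "((\<lambda>y. 1 + \<mu> y) has_real_derivative
        p + bmean (bmult \<mu> \<omega>) - (p + \<omega> y) * (1 + \<mu> y)) (at y)" by simp
  next
    show "mean (\<lambda>y. p + \<omega> y) = p" "mean (\<lambda>y. 1 + \<mu> y) = 1"
      using \<mu> \<omega> mean_add[OF continuous_on_const continuous_on_apply_bcontfun] by simp_all
  qed
qed

section \<open>The derivative of the effective Hamiltonian\<close>

lemma has_derivative_bmean_bmult:
  fixes f g :: "real \<Rightarrow> cb"
  assumes "(f has_vector_derivative f') (at p)" "(g has_vector_derivative g') (at p)"
  shows "((\<lambda>q. bmean (bmult (f q) (g q))) has_real_derivative
           bmean (bmult (f p) g') + bmean (bmult f' (g p))) (at p)"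
  using bounded_linear.has_vector_derivative[OF bounded_linear_bmean
      bounded_bilinear.has_vector_derivative[OF bounded_bilinear_bmult assms]]
  by (simp add: has_real_derivative_iff_has_vector_derivative linear_simps(1)[OF bounded_linear_bmean])

lemma bmult_commute: "bmult a b = bmult b a"
  by (rule bcontfun_eqI) simp

text \<open>
  By \<open>profile_difference\<close>, \<open>H(q)\<close> equals the function \<open>k\<close> of the proof, in which the only terms of
  first order at \<open>q = p\<close> are \<open>b(p) (q - p)\<close> and \<open>- \<integral> \<mu>\<^sub>p \<mu>\<^sub>q\<close>; the term quadratic in \<open>w\<^sub>p - w\<^sub>q\<close> does
  not contribute. The subtracted \<open>\<integral> \<mu>\<^sub>p (d\<mu>\<^sub>p/dp)\<close> is half the derivative of \<open>\<integral> m\<^sub>p\<^sup>2\<close> in \<open>p\<close>,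
  because \<open>\<mu>\<^sub>p\<close> has mean zero.
\<close>

lemma effective_derivative:
  fixes M W :: "real \<Rightarrow> cb"
  assumes v: "C1_torus v"
    and prof: "\<And>q. \<bar>q\<bar> \<le> r \<Longrightarrow> profile v q 1 (h q) (\<lambda>y. q + W q y) (\<lambda>y. 1 + M q y)"
    and p: "\<bar>p\<bar> < r"
    and dM: "(M has_vector_derivative M') (at p)" and dW: "(W has_vector_derivative W') (at p)"
  shows "((\<lambda>q. Hbar v q 1) has_real_derivative bbar v p 1 - bmean (bmult (M p) M')) (at p)"
proof -
  note bmean_simps = linear_simps(1,2,3,4,5)[OF bounded_linear_bmean]
  let ?one = "const_bcontfun 1 :: cb"
  define c where "c = bbar v p 1"
  define d where "d = (\<lambda>q. (p - q) *\<^sub>R ?one + W p - W q)"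
  define k where "k = (\<lambda>q. h p + c * (q - p) + bmean (bmult (?one + M p) (bmult (d q) (d q))) / 2
      + (bmean (bmult (M p) (M p)) - bmean (bmult (M p) (M q))))"
  have eff: "Hbar v q 1 = h q" "bbar v q 1 = mean (\<lambda>y. (q + W q y) * (1 + M q y))" if "\<bar>q\<bar> \<le> r" for q
    using effective_eq[OF v prof[OF that]] by simp_all
  have mean0: "bmean (M q) = 0" if "\<bar>q\<bar> \<le> r" for q
    using prof[OF that] mean_add[OF continuous_on_const continuous_on_apply_bcontfun, of 1 "M q"]
    by (simp add: profile_def bmean_def)
  have eq: "Hbar v q 1 = k q" if q: "\<bar>q\<bar> \<le> r" for q
  proof -
    have p': "\<bar>p\<bar> \<le> r" using p by simp
    have "mean (\<lambda>y. (1 + M p y) * (p + W p y - (q + W q y))\<^sup>2) = bmean (bmult (?one + M p) (bmult (d q) (d q)))"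
      unfolding bmean_def
      by (intro arg_cong[where f = mean] ext) (simp add: d_def const_bcontfun.rep_eq power2_eq_square algebra_simps)
    moreover have "mean (\<lambda>y. (1 + M p y) * (1 + M p y - (1 + M q y)))
        = bmean (M p - M q + (bmult (M p) (M p) - bmult (M p) (M q)))"
      unfolding bmean_def by (intro arg_cong[where f = mean] ext) (simp add: algebra_simps)
    ultimately show ?thesis
      using profile_difference[OF prof[OF p'] prof[OF q]] eff(1)[OF q] eff(2)[OF p'] mean0[OF p'] mean0[OF q]
      by (simp add: k_def c_def bmean_simps algebra_simps)
  qed
  have dd: "(d has_vector_derivative - ?one - W') (at p)"
    unfolding d_def by (auto intro!: derivative_eq_intros dW)
  have dp: "d p = 0" by (simp add: d_def)
  have zero: "bmult a 0 = 0" "bmult 0 a = 0" for a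
    by (rule bcontfun_eqI, simp)+
  have dbd: "((\<lambda>q. bmult (d q) (d q)) has_vector_derivative 0) (at p)"
    using bounded_bilinear.has_vector_derivative[OF bounded_bilinear_bmult dd dd] by (simp add: dp zero)
  have quad: "((\<lambda>q. bmean (bmult (?one + M p) (bmult (d q) (d q)))) has_real_derivative 0) (at p)"
    using has_derivative_bmean_bmult[OF has_vector_derivative_const[of "?one + M p"] dbd]
    by (simp add: dp zero bmean_simps)
  have cross: "((\<lambda>q. bmean (bmult (M p) (M q))) has_real_derivative bmean (bmult (M p) M')) (at p)"
    using has_derivative_bmean_bmult[OF has_vector_derivative_const[of "M p"] dM]
    by (simp add: zero bmean_simps)
  have "(k has_real_derivative c - bmean (bmult (M p) M')) (at p)"
    unfolding k_def by (auto intro!: derivative_eq_intros quad cross)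
  then show ?thesis unfolding c_def
    by (rule has_field_derivative_transform_within_open[where S = "ball 0 r"])
       (use eq p in \<open>auto simp: dist_real_def\<close>)
qed

section \<open>The linear problem with a cosine potential\<close>

definition cosb :: cb where "cosb = Bcontfun (\<lambda>y. cos (2 * pi * y))"
definition sinb :: cb where "sinb = Bcontfun (\<lambda>y. sin (2 * pi * y))"

lemma cosb_apply [simp]: "cosb y = cos (2 * pi * y)"
  unfolding cosb_def
  by (subst Bcontfun_inverse) (auto intro!: bcontfun_normI[where b = 1] continuous_intros)

lemma sinb_apply [simp]: "sinb y = sin (2 * pi * y)"
  unfolding sinb_def
  by (subst Bcontfun_inverse) (auto intro!: bcontfun_normI[where b = 1] continuous_intros)

lemma cos_sin_periodic: "cos (2 * pi * (y + 1)) = cos (2 * pi * y)" "sin (2 * pi * (y + 1)) = sin (2 * pi * y)"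
  by (simp_all add: distrib_left)

lemma cosb_sin_derivs:
  "((\<lambda>y. sin (2 * pi * y)) has_real_derivative 2 * pi * cos (2 * pi * y)) (at y)"
  "((\<lambda>y. cos (2 * pi * y)) has_real_derivative - (2 * pi * sin (2 * pi * y))) (at y)"
  by (auto intro!: derivative_eq_intros)

lemma mean_trig: "mean (\<lambda>y. cos (2 * pi * y)) = 0" "mean (\<lambda>y. sin (2 * pi * y)) = 0"
  using periodic_mean_deriv[OF cosb_sin_derivs(1)] periodic_mean_deriv[OF cosb_sin_derivs(2)] cos_sin_periodic
  by (simp_all)

lemma J_cosb: "J cosb = (1 / (2 * pi)) *\<^sub>R sinb"
proof (rule bcontfun_eqI)
  fix y
  have "osc_primitive (\<lambda>y. cos (2 * pi * y)) y = sin (2 * pi * y) / (2 * pi)"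
    by (rule osc_primitive_eq[where F = "\<lambda>y. sin (2 * pi * y) / (2 * pi)"])
       (auto intro!: derivative_eq_intros continuous_intros simp: cos_sin_periodic mean_trig)
  then show "J cosb y = ((1 / (2 * pi)) *\<^sub>R sinb) y" by (simp add: cosb_apply[abs_def])
qed

lemma J_sinb: "J sinb = (- 1 / (2 * pi)) *\<^sub>R cosb"
proof (rule bcontfun_eqI)
  fix y
  have "osc_primitive (\<lambda>y. sin (2 * pi * y)) y = - (cos (2 * pi * y) / (2 * pi))"
    by (rule osc_primitive_eq[where F = "\<lambda>y. - (cos (2 * pi * y) / (2 * pi))"])
       (auto intro!: derivative_eq_intros continuous_intros simp: cos_sin_periodic mean_trig)
  then show "J sinb y = ((- 1 / (2 * pi)) *\<^sub>R cosb) y" by (simp add: sinb_apply[abs_def])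
qed

lemma bmean_cosb: "bmean cosb = 0"
  using mean_trig by (simp add: bmean_def cosb_apply[abs_def])

lemma bmean_cosb_sq: "bmean (bmult cosb cosb) = 1/2"
proof -
  have d: "((\<lambda>y. sin (2 * pi * y) * cos (2 * pi * y) / (4 * pi) + y / 2) has_real_derivative
      cos (2 * pi * y) * cos (2 * pi * y)) (at y)" for y
  proof -
    have s: "sin (2 * pi * y) * sin (2 * pi * y) = 1 - cos (2 * pi * y) * cos (2 * pi * y)"
      using sin_cos_squared_add[of "2 * pi * y"] by (simp add: power2_eq_square)
    have e: "(2 * pi * cos (2 * pi * y) * cos (2 * pi * y) - 2 * pi * (sin (2 * pi * y) * sin (2 * pi * y))) / (4 * pi) + 1/2
        = cos (2 * pi * y) * cos (2 * pi * y)"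
      unfolding s by (simp add: field_simps)
    have "((\<lambda>y. sin (2 * pi * y) * cos (2 * pi * y) / (4 * pi) + y / 2) has_real_derivative
        (2 * pi * cos (2 * pi * y) * cos (2 * pi * y) - 2 * pi * (sin (2 * pi * y) * sin (2 * pi * y))) / (4 * pi) + 1/2) (at y)"
      by (rule derivative_eq_intros cosb_sin_derivs refl | simp)+ (simp add: field_simps)
    then show ?thesis unfolding e .
  qed
  show ?thesis unfolding bmean_def bmult_apply[abs_def] cosb_apply using mean_deriv[OF d] by simp
qed

lemma norm_cosb: "norm cosb \<le> 1"
  by (rule norm_bound) simp

text \<open>
  Eliminating \<open>\<omega> = - \<mu>' - p \<mu>\<close> from the linear problem leaves \<open>\<mu>'' - (p\<^sup>2 + 1) \<mu> = \<epsilon> cos (2 \<pi> y)\<close>,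
  whose periodic solution is the first component.
\<close>

definition linear_state :: "real \<Rightarrow> real \<Rightarrow> cb \<times> cb" where
  "linear_state \<epsilon> p = (let D = 4 * pi\<^sup>2 + p\<^sup>2 + 1 in
     ((- \<epsilon> / D) *\<^sub>R cosb, (\<epsilon> / D) *\<^sub>R (p *\<^sub>R cosb - (2 * pi) *\<^sub>R sinb)))"

lemma linear_state_eq:
  "linear_state \<epsilon> p = opA (linear_state \<epsilon> p) + p *\<^sub>R opB (linear_state \<epsilon> p) + (0, - J (\<epsilon> *\<^sub>R cosb))"
proof -
  define D where "D = 4 * pi\<^sup>2 + p\<^sup>2 + 1"
  have D: "D > 0" by (auto simp: D_def intro: add_nonneg_pos)
  have key: "\<epsilon> * (p * c - 2 * pi * s) / D =
      \<epsilon> * s / (D * (2 * pi)) + p * \<epsilon> * (p * s / (2 * pi) + c) / D - \<epsilon> * s / (2 * pi)" for c s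
  proof -
    have "\<epsilon> * s / (D * (2 * pi)) + p * \<epsilon> * (p * s / (2 * pi) + c) / D - \<epsilon> * s / (2 * pi)
        = (\<epsilon> * s + p * \<epsilon> * (p * s + 2 * pi * c) - \<epsilon> * s * D) / (2 * pi * D)"
      using D by (simp add: field_simps)
    also have "\<epsilon> * s + p * \<epsilon> * (p * s + 2 * pi * c) - \<epsilon> * s * D = 2 * pi * (\<epsilon> * (p * c - 2 * pi * s))"
      by (simp add: D_def power2_eq_square algebra_simps)
    finally show ?thesis using D by simp
  qed
  show ?thesis
    unfolding linear_state_def Let_def D_def[symmetric] opA_def opB_def
    by (auto simp: J_simps J_cosb J_sinb prod_eq_iff key add_divide_distrib distrib_left
        intro!: bcontfun_eqI)
qed

section \<open>The effective operators differ\<close>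

theorem mainTheorem3:
  shows "\<exists>(v :: real \<Rightarrow> real) (P :: real) (\<alpha> :: real).
    C1_torus v \<and> (\<forall>y. 0 \<le> v y) \<and> 0 \<le> \<alpha> \<and>
    (\<lambda>Q. Hbar v Q \<alpha>) field_differentiable (at P) \<and>
    deriv (\<lambda>Q. Hbar v Q \<alpha>) P \<noteq> bbar v P \<alpha>"
proof -
  \<comment> \<open>\<open>\<delta>\<close> separates the leading coefficients of \<open>\<integral> \<mu>\<^sup>2\<close> at \<open>P = 0\<close> and \<open>P = 1/8\<close>; the error terms add up
    to \<open>96 \<epsilon>\<^sup>3\<close>, so \<open>\<epsilon> \<le> \<delta>/100\<close> suffices.\<close>
  define D where "D = (\<lambda>p::real. 4 * pi\<^sup>2 + p\<^sup>2 + 1)"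
  define \<delta> where "\<delta> = 1 / (2 * (D 0)\<^sup>2) - 1 / (2 * (D (1/8))\<^sup>2)"
  define \<epsilon> where "\<epsilon> = min (1/32) (\<delta> / 100)"
  have D: "1 \<le> D p" for p by (simp add: D_def)
  have "0 < D 0" "D 0 < D (1/8)" using D[of 0] by (linarith, simp add: D_def)
  then have "(D 0)\<^sup>2 < (D (1/8))\<^sup>2" "0 < (D 0)\<^sup>2" by (auto intro!: power_strict_mono)
  then have \<delta>: "0 < \<delta>" by (simp add: \<delta>_def frac_less2)
  have \<epsilon>: "0 < \<epsilon>" "\<epsilon> \<le> 1/32" "100 * \<epsilon> \<le> \<delta>" using \<delta> by (auto simp: \<epsilon>_def min_def)
  let ?f = "\<epsilon> *\<^sub>R cosb"
  let ?v = "\<lambda>y. \<epsilon> + ?f y"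
  let ?z = "(0, - J ?f) :: cb \<times> cb"
  have "\<epsilon> * norm cosb \<le> \<epsilon> * 1" using norm_cosb \<epsilon>(1) by (intro mult_left_mono) auto
  moreover have "norm ?z = norm (J ?f)" by (simp add: norm_Pair)
  moreover have "norm (J ?f) \<le> \<epsilon> * norm cosb / 2" using norm_J[of ?f] \<epsilon>(1) by simp
  ultimately have nz: "norm ?z \<le> \<epsilon> / 2" by linarith
  interpret quadratic_perturbation opA opB opQ ?z
    by (rule quadratic_perturbation_torus) (use nz \<epsilon> in simp)
  have "\<exists>x. x \<in> periodic_pairs \<and> branch p x" if p: "\<bar>p\<bar> \<le> 1/4" for p
  proof -
    have "T p x \<in> periodic_pairs" if x: "x \<in> periodic_pairs" for x
    proof -
      have per: "periodic ?f" by (simp add: cos_sin_periodic)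
      note J_periodic[of "fst x"] J_periodic[of "snd x"] J_periodic[of "bmult (fst x) (snd x)"]
        J_periodic[of "bmult (snd x) (snd x)"] J_periodic[OF per]
      with x show ?thesis
        by (simp add: periodic_pairs_def T_def opA_def opB_def opQ_def del: J_apply)
    qed
    moreover have "0 \<in> periodic_pairs" by (simp add: periodic_pairs_def)
    ultimately show ?thesis using branch_exists[OF p closed_periodic_pairs] by metis
  qed
  then obtain X where X: "\<And>p. \<bar>p\<bar> \<le> 1/4 \<Longrightarrow> X p \<in> periodic_pairs \<and> branch p (X p)"
    by metis
  define M where "M = (\<lambda>p. fst (X p))"
  define W where "W = (\<lambda>p. snd (X p))"
  define h where "h = (\<lambda>p. p\<^sup>2/2 - 1 + bmean (bmult (W p) (W p)) / 2 - \<epsilon>)"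
  define s where "s = (\<lambda>p. bmean (bmult (M p) (M p)))"
  have prof: "profile ?v p 1 (h p) (\<lambda>y. p + W p y) (\<lambda>y. 1 + M p y)" if p: "\<bar>p\<bar> \<le> 1/4" for p
    unfolding h_def
  proof (rule profile_of_fixed_point(1))
    show "periodic ?f" by (simp add: cos_sin_periodic)
    show "bmean ?f = 0" using bmean_cosb by (simp add: linear_simps(5)[OF bounded_linear_bmean])
    show "periodic (M p)" "periodic (W p)" using X[OF p] by (auto simp: periodic_pairs_def M_def W_def)
    show "opA (M p, W p) + p *\<^sub>R opB (M p, W p) + opQ (M p, W p) (M p, W p) + ?z = (M p, W p)"
      using X[OF p] by (simp add: M_def W_def branch_def T_def)
  qed
  have s_approx: "\<bar>s p - \<epsilon>\<^sup>2 / (2 * (D p)\<^sup>2)\<bar> \<le> 48 * \<epsilon>^3" if p: "\<bar>p\<bar> \<le> 1/4" for p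
  proof -
    let ?a = "(- \<epsilon> / D p) *\<^sub>R cosb"
    have y: "linear_state \<epsilon> p = (?a, snd (linear_state \<epsilon> p))"
      by (simp add: linear_state_def Let_def D_def)
    have nX: "norm (X p) \<le> 2 * \<epsilon>" using branch_norm[OF p] X[OF p] nz by fastforce
    have "norm (X p - linear_state \<epsilon> p) \<le> 4 * (norm (X p))\<^sup>2"
      using branch_linear_approx[OF p _ linear_state_eq] X[OF p] by blast
    also have "\<dots> \<le> 4 * (2 * \<epsilon>)\<^sup>2" using nX by (intro mult_left_mono power_mono) auto
    finally have "norm (X p - linear_state \<epsilon> p) \<le> 16 * \<epsilon>\<^sup>2" by (simp add: power2_eq_square)
    moreover have "norm (M p - ?a) \<le> norm (X p - linear_state \<epsilon> p)"
      using norm_fst_le[of "fst (X p - linear_state \<epsilon> p)" "snd (X p - linear_state \<epsilon> p)"] y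
      by (metis M_def fst_conv fst_diff prod.collapse)
    ultimately have n1: "norm (M p - ?a) \<le> 16 * \<epsilon>\<^sup>2" by linarith
    have nM: "norm (M p) \<le> 2 * \<epsilon>"
      using norm_fst_le[of "fst (X p)" "snd (X p)"] nX by (simp add: M_def)
    have "norm ?a \<le> \<epsilon> / D p * 1"
      unfolding norm_scaleR using D[of p] \<epsilon> norm_cosb by (intro mult_mono) auto
    also have "\<dots> \<le> \<epsilon>" using D[of p] \<epsilon> by (simp add: divide_le_eq)
    finally have n2: "norm (M p + ?a) \<le> 3 * \<epsilon>" using nM norm_triangle_ineq[of "M p" ?a] by linarith
    have "bmean (bmult ?a ?a) = (- \<epsilon> / D p) * ((- \<epsilon> / D p) * bmean (bmult cosb cosb))"
      by (simp only: bmult_simps linear_simps(5)[OF bounded_linear_bmean] real_scaleR_def)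
    then have a: "bmean (bmult ?a ?a) = \<epsilon>\<^sup>2 / (2 * (D p)\<^sup>2)"
      by (simp add: bmean_cosb_sq power2_eq_square)
    have "bmult (M p) (M p) - bmult ?a ?a = bmult (M p - ?a) (M p + ?a)"
      by (rule bcontfun_eqI) (simp add: algebra_simps)
    then have "s p - \<epsilon>\<^sup>2 / (2 * (D p)\<^sup>2) = bmean (bmult (M p - ?a) (M p + ?a))"
      using a by (metis s_def linear_simps(2)[OF bounded_linear_bmean])
    also have "\<bar>\<dots>\<bar> \<le> norm (M p - ?a) * norm (M p + ?a)"
      using bmean_bound norm_bmult by (rule order_trans)
    also have "\<dots> \<le> 16 * \<epsilon>\<^sup>2 * (3 * \<epsilon>)" using n1 n2 by (intro mult_mono) auto
    finally show ?thesis by (simp add: power2_eq_square power3_eq_cube)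
  qed
  have s_neq: "s (1/8) \<noteq> s 0"
  proof
    assume "s (1/8) = s 0"
    then have "\<epsilon>\<^sup>2 / (2 * (D 0)\<^sup>2) - \<epsilon>\<^sup>2 / (2 * (D (1/8))\<^sup>2) \<le> 96 * \<epsilon>^3"
      using s_approx[of 0] s_approx[of "1/8"] by (simp add: abs_le_iff)
    then have "\<epsilon>\<^sup>2 * \<delta> \<le> \<epsilon>\<^sup>2 * (96 * \<epsilon>)"
      by (simp add: \<delta>_def right_diff_distrib power2_eq_square power3_eq_cube)
    then have "\<delta> \<le> 96 * \<epsilon>" using \<epsilon>(1) by simp
    then show False using \<epsilon> by simp
  qed
  have "\<forall>p. \<exists>M' W'. \<bar>p\<bar> < 1/4 \<longrightarrow>
      (M has_vector_derivative M') (at p) \<and> (W has_vector_derivative W') (at p)"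
  proof (intro allI)
    fix p
    show "\<exists>M' W'. \<bar>p\<bar> < 1/4 \<longrightarrow>
      (M has_vector_derivative M') (at p) \<and> (W has_vector_derivative W') (at p)"
    proof (cases "\<bar>p\<bar> < 1/4")
      case True
      then obtain X' where "(X has_vector_derivative X') (at p)"
        using branch_differentiable[of X p] X by blast
      then have "(M has_vector_derivative fst X') (at p)" "(W has_vector_derivative snd X') (at p)"
        unfolding M_def W_def
        by (rule bounded_linear.has_vector_derivative[OF bounded_linear_fst]
            bounded_linear.has_vector_derivative[OF bounded_linear_snd])+
      then show ?thesis by blast
    qed auto
  qed
  then obtain M' W' where der: "\<And>p. \<bar>p\<bar> < 1/4 \<Longrightarrow>
      (M has_vector_derivative M' p) (at p) \<and> (W has_vector_derivative W' p) (at p)"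
    by metis
  have ds: "(s has_real_derivative 2 * bmean (bmult (M p) (M' p))) (at p)" if "\<bar>p\<bar> < 1/4" for p
    unfolding s_def
    using has_derivative_bmean_bmult[of M "M' p" p M "M' p"] der[OF that] bmult_commute[of "M' p" "M p"]
    by simp
  obtain p where p: "0 < p" "p < 1/8" "s (1/8) - s 0 = (1/8 - 0) * (2 * bmean (bmult (M p) (M' p)))"
    using MVT2[of 0 "1/8" s "\<lambda>p. 2 * bmean (bmult (M p) (M' p))"] ds by auto
  have v: "C1_torus ?v"
  proof (rule C1_torusI)
    show "(?v has_real_derivative - (\<epsilon> * (2 * pi * sin (2 * pi * y)))) (at y)" for y
      by (auto intro!: derivative_eq_intros)
    show "continuous_on UNIV (\<lambda>y. - (\<epsilon> * (2 * pi * sin (2 * pi * y))))" by (intro continuous_intros)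
    show "?v (y + 1) = ?v y" for y by (simp add: cos_sin_periodic)
  qed
  have pos: "0 \<le> ?v y" for y
    using mult_left_mono[of "-1" "cos (2 * pi * y)" \<epsilon>] \<epsilon> by simp
  have "((\<lambda>q. Hbar ?v q 1) has_real_derivative bbar ?v p 1 - bmean (bmult (M p) (M' p))) (at p)"
    by (rule effective_derivative[where r = "1/4", OF v prof]) (use der[of p] p in auto)
  moreover have "bmean (bmult (M p) (M' p)) \<noteq> 0" using p s_neq by auto
  ultimately have "(\<lambda>Q. Hbar ?v Q 1) field_differentiable (at p)"
    "deriv (\<lambda>Q. Hbar ?v Q 1) p \<noteq> bbar ?v p 1"
    by (auto simp: field_differentiable_def dest: DERIV_imp_deriv)
  then show ?thesis using v pos by (intro exI[of _ ?v] exI[of _ p] exI[of _ 1]) simp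
qed

end
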